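(* Let $n,m \in \mathbb{N}$ ($n,m\ge1$), $a,b,c,d \in \mathbb{R}$, and let $\lambda_1,\dots,\lambda_{n+2}$, $\mathbf{H}_n$, and (according to the parity of $n$) $\mathbf{u},\mathbf{v},\mathbf{R}_n,\mathbf{P}_n$ and the polynomials $F,G$ be as defined in the context. (a) Suppose $n$ is even, $\lambda_{1},\lambda_{3},\ldots,\lambda_{n+1}$ are all distinct and $\lambda_{2},\lambda_{4},\ldots,\lambda_{n+2}$ are all distinct. Put $N=M=n/2$ and $\lambda_*=\lambda_{n+2}$. Let $\phi_{1},\ldots, \phi_{N}$ be the zeros of $F$ and $\psi_{1},\ldots, \psi_{M}$ the zeros of $G$. Then $$\mathbf{H}_{n}^{m} = \mathbf{R}_{n} \mathbf{P}_{n}^{\top} \begin{bmatrix}\mathbf{F}_{N} & \mathbf{O} \\ \mathbf{O} & \mathbf{G}_{M}\end{bmatrix} \mathrm{diag}\left(\phi_{1}^{m}, \ldots, \phi_{N}^{m},\psi_{1}^{m},\ldots,\psi_{M}^{m} \right)\begin{bmatrix}\mathbf{F}_{N}^{-1} & \mathbf{O} \\ \mathbf{O} & \mathbf{G}_{M}^{-1}\end{bmatrix} \begin{bmatrix}\mathbf{I}_{N} + \mathbf{u} \mathbf{u}^{\top} & \mathbf{O} \\ \mathbf{O} & \mathbf{I}_{M} + \mathbf{v} \mathbf{v}^{\top}\end{bmatrix} \mathbf{P}_{n} \mathbf{R}_{n}.\qquad( * )$$ Moreover, if $\mathbf{H}_{n}$ is nonsingular then $( * )$ holds for any integer $m$.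 (b) Suppose $n$ is odd, $\lambda_{1},\lambda_{3},\ldots,\lambda_{n},\lambda_{n+2}$ are all distinct and $\lambda_{2},\lambda_{4},\ldots,\lambda_{n-1},\lambda_{n+1}$ are all distinct. Put $N=\frac{n+1}2$, $M=\frac{n-1}2$ and $\lambda_*=\lambda_{n+1}$. Let $\phi_{1},\ldots, \phi_{N}$ be the zeros of $F$ and $\psi_{1},\ldots, \psi_{M}$ the zeros of $G$. Then $$\mathbf{H}_{n}^{m} = \mathbf{R}_{n} \mathbf{P}_{n} \begin{bmatrix}\mathbf{F}_{N} & \mathbf{O} \\ \mathbf{O} & \mathbf{G}_{M}\end{bmatrix} \mathrm{diag}\left(\phi_{1}^{m}, \ldots, \phi_{N}^{m},\psi_{1}^{m},\ldots,\psi_{M}^{m} \right)\begin{bmatrix}\mathbf{F}_{N}^{-1} & \mathbf{O} \\ \mathbf{O} & \mathbf{G}_{M}^{-1}\end{bmatrix} \begin{bmatrix}\mathbf{I}_{N} + \mathbf{u} \mathbf{u}^{\top} & \mathbf{O} \\ \mathbf{O} & \mathbf{I}_{M} + \mathbf{v} \mathbf{v}^{\top}\end{bmatrix} \mathbf{P}_{n}^{\top} \mathbf{R}_{n}^{\top}.\qquad( ** )$$ Furthermore, if $\mathbf{H}_{n}$ is nonsingular then $( ** )$ is valid for every integer $m$. In both parts, $$\mathbf{F}_{N} = \left[\frac{(\lambda_{2k+1} - \lambda_{1}) \sin\left(\frac{(2k+1)\pi}{n + 3} \right)}{\lambda_{2k+1} - \phi_{\ell}} \right]_{1\le k,\ell\le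 N},\qquad \mathbf{G}_{M} = \left[\frac{(\lambda_{2k} - \lambda_{*}) \sin\left(\frac{2k\pi}{n + 3} \right)}{\lambda_{2k} - \psi_{\ell}}\right]_{1\le k,\ell\le M},$$ and their inverses are the matrices $$\mathbf{F}_{N}^{-1} = (-1)^{N} \left[\frac{\prod_{j=1}^{N} (\phi_{k} - \lambda_{2j+1}) \prod_{j\ne k} (\phi_{j} - \lambda_{2\ell+1})}{(\lambda_{2\ell + 1} - \lambda_{1}) \sin \left(\frac{(2\ell+1)\pi}{n + 3} \right) \prod_{j\neq k} (\phi_{k} - \phi_{j}) \prod_{j\neq \ell} (\lambda_{2\ell + 1} - \lambda_{2j + 1})} \right]_{1\le k,\ell\le N},$$ $$\mathbf{G}_{M}^{-1} = (-1)^{M} \left[\frac{\prod_{j=1}^{M} (\psi_{k} - \lambda_{2j}) \prod_{j\neq k} (\psi_{j} - \lambda_{2\ell})}{(\lambda_{2\ell} - \lambda_{*}) \sin \left(\frac{2\ell\pi}{n + 3} \right) \prod_{j\neq k} (\psi_{k} - \psi_{j}) \prod_{j\neq \ell} (\lambda_{2\ell} - \lambda_{2j})} \right]_{1\le k,\ell\le M},$$ where the restricted products run over $1\le j\le N$ (for $\mathbf{F}_N^{-1}$) or $1\le j\le M$ (for $\mathbf{G}_M^{-1}$) subject to the indicated condition.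
   Context: For $n\in\mathbb{N}$ and scalars $a,b,c,d$, $\mathbf{H}_n$ is the $n\times n$ anti-heptadiagonal persymmetric Hankel matrix with entries $[\mathbf{H}_n]_{k,\ell}=d$ if $k+\ell=n+1$; $=c$ if $|k+\ell-n-1|=1$; $=b$ if $|k+\ell-n-1|=2$; $=a$ if $|k+\ell-n-1|=3$; and $=0$ otherwise. For $k=1,2,\ldots,n+2$, $$\lambda_{k} = -2a \cos \left(\tfrac{n k \pi}{n+3} \right) - 2b \cos \left(\tfrac{(n + 1) k \pi}{n+3} \right) - 2c \cos \left(\tfrac{(n + 2) k \pi}{n+3} \right) - d \cos (k \pi).$$ Case $n$ even. $\mathbf{u},\mathbf{v}\in\mathbb{R}^{n/2}$ with $u_j=\frac{\sin((2j+1)\pi/(n+3))}{\sin(\pi/(n+3))}$, $v_j=\frac{\sin(2j\pi/(n+3))}{\sin(\pi/(n+3))}$, $1\le j\le n/2$. $\mathbf{R}_n$ is the $n\times n$ matrix $[\mathbf{R}_n]_{k,\ell}=\sqrt{\frac{2}{n+3}}\sin\left(\frac{(k+1)(\ell+1)\pi}{n+3}\right)$. $\mathbf{P}_n$ is the $n\times n$ permutation matrix with $[\mathbf{P}_n]_{k,\ell}=1$ if $\ell=2k$ or $\ell=2k-n-1$, and $0$ otherwise. The polynomials are $$F(t) = \prod_{j=1}^{n/2}(t - \lambda_{2j+1}) + \frac{4}{n + 3} \sum_{j=1}^{n/2} \sin^{2} \left(\frac{(2j + 1) \pi}{n + 3} \right) (\lambda_{2j+1} - \lambda_{1}) \prod_{\substack{m=1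 \\ m \neq j}}^{n/2}(t - \lambda_{2m+1}),$$ $$G(t) = \prod_{j=1}^{n/2}(t - \lambda_{2j}) + \frac{4}{n + 3} \sum_{j=1}^{n/2} \sin^{2} \left(\frac{2j \pi}{n + 3} \right) (\lambda_{2j} - \lambda_{n+2}) \prod_{\substack{m=1 \\ m \neq j}}^{n/2}(t - \lambda_{2m}).$$ Case $n$ odd. $\mathbf{u}\in\mathbb{R}^{(n+1)/2}$ with $u_j=\frac{\sin((2j+1)\pi/(n+3))}{\sin(\pi/(n+3))}$, $1\le j\le \frac{n+1}2$ (so the last component is $1$), and $\mathbf{v}\in\mathbb{R}^{(n-1)/2}$ with $v_j=\frac{\sin(2j\pi/(n+3))}{\sin((n+1)\pi/(n+3))}$, $1\le j\le\frac{n-1}2$. $\mathbf{R}_n$ is the $n\times n$ matrix with $[\mathbf{R}_n]_{k,\ell}=\sqrt{\frac{2}{n+3}}\sin\left(\frac{(k+1)(\ell+1)\pi}{n+3}\right)$ if $\ell<n$ and $[\mathbf{R}_n]_{k,n}=\sqrt{\frac{2}{n+3}}\sin\left(\frac{(k+1)(n+2)\pi}{n+3}\right)$. $\mathbf{P}_n$ is the $n\times n$ permutation matrix with $[\mathbf{P}_n]_{k,\ell}=1$ if $k=2\ell$, or $k=2\ell-n-2$, or ($k=n$ and $\ell=\frac{n+1}2$), and $0$ otherwise. The polynomials are $$F(t) = \prod_{j=1}^{(n+1)/2}(t - \lambda_{2j+1}) + \frac{4}{n + 3} \sum_{j=1}^{(n+1)/2} \sin^{2} \left(\frac{(2j + 1)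 \pi}{n + 3} \right) (\lambda_{2j+1} - \lambda_{1}) \prod_{\substack{m=1 \\ m \neq j}}^{(n+1)/2}(t - \lambda_{2m+1}),$$ $$G(t) = \prod_{j=1}^{(n-1)/2}(t - \lambda_{2j}) + \frac{4}{n + 3} \sum_{j=1}^{(n-1)/2} \sin^{2} \left(\frac{2j \pi}{n + 3} \right) (\lambda_{2j} - \lambda_{n+1}) \prod_{\substack{m=1 \\ m \neq j}}^{(n-1)/2}(t - \lambda_{2m}).$$ (In these polynomials $m$ is only a product index.) Zeros are listed with multiplicity. $\mathbf{O}$ denotes zero blocks; for $n=1$ blocks of size $(n-1)/2=0$ are absent. *)

theory Defs
  imports
    Complex_Main
    "HOL-Computational_Algebra.Polynomial"
    "Jordan_Normal_Form.Gauss_Jordan_Elimination"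
begin

text \<open>Matrices of the library are indexed from 0; \<open>mat1 r c f\<close> is the \<open>r \<times> c\<close> matrix whose entry in
  row \<open>k\<close> and column \<open>l\<close>, counted from 1, is \<open>f k l\<close>.\<close>

definition mat1 :: "nat \<Rightarrow> nat \<Rightarrow> (nat \<Rightarrow> nat \<Rightarrow> 'a) \<Rightarrow> 'a mat" where
  "mat1 r c f = mat r c (\<lambda>(i, j). f (i + 1) (j + 1))"

text \<open>Only meaningful for negative exponents if \<open>A\<close> is nonsingular.\<close>

definition mat_powi :: "'a :: field mat \<Rightarrow> int \<Rightarrow> 'a mat" where
  "mat_powi A m = (if 0 \<le> m then A ^\<^sub>m nat m else the (mat_inverse A) ^\<^sub>m nat (- m))"

abbreviation cmat :: "real mat \<Rightarrow> complex mat" where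
  "cmat \<equiv> map_mat complex_of_real"

text \<open>\<open>z\<^sub>1, \<dots>, z\<^sub>N\<close> is an enumeration, in any order, of the complex zeros of \<open>p\<close> with multiplicity.\<close>

definition lists_zeros :: "real poly \<Rightarrow> nat \<Rightarrow> (nat \<Rightarrow> complex) \<Rightarrow> bool" where
  "lists_zeros p N z \<longleftrightarrow> image_mset z (mset_set {1..N}) = proots (map_poly complex_of_real p)"

definition hankel_mat :: "nat \<Rightarrow> real \<Rightarrow> real \<Rightarrow> real \<Rightarrow> real \<Rightarrow> real mat" where
  "hankel_mat n a b c d = mat1 n n (\<lambda>k l.
     let s = \<bar>int k + int l - int n - 1\<bar> in
     if s = 0 then d else if s = 1 then c else if s = 2 then b else if s = 3 then a else 0)"

definition lam :: "nat \<Rightarrow> real \<Rightarrow> real \<Rightarrow> real \<Rightarrow> real \<Rightarrow> nat \<Rightarrow> real" where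
  "lam n a b c d k =
     - 2 * a * cos (real n * real k * pi / (real n + 3))
     - 2 * b * cos ((real n + 1) * real k * pi / (real n + 3))
     - 2 * c * cos ((real n + 2) * real k * pi / (real n + 3))
     - d * cos (real k * pi)"

abbreviation sn :: "nat \<Rightarrow> nat \<Rightarrow> real" where
  "sn n k \<equiv> sin (real k * pi / (real n + 3))"

text \<open>The vectors \<open>u\<close> and \<open>v\<close> are column matrices.\<close>

definition u_vec :: "nat \<Rightarrow> nat \<Rightarrow> real mat" where
  "u_vec n N = mat1 N 1 (\<lambda>j _. sn n (2 * j + 1) / sn n 1)"

definition v_vec_even :: "nat \<Rightarrow> nat \<Rightarrow> real mat" where
  "v_vec_even n M = mat1 M 1 (\<lambda>j _. sn n (2 * j) / sn n 1)"

definition v_vec_odd :: "nat \<Rightarrow> nat \<Rightarrow> real mat" where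
  "v_vec_odd n M = mat1 M 1 (\<lambda>j _. sn n (2 * j) / sn n (n + 1))"

definition R_even :: "nat \<Rightarrow> real mat" where
  "R_even n = mat1 n n (\<lambda>k l. sqrt (2 / (real n + 3)) * sn n ((k + 1) * (l + 1)))"

definition R_odd :: "nat \<Rightarrow> real mat" where
  "R_odd n = mat1 n n (\<lambda>k l. sqrt (2 / (real n + 3)) *
     (if l < n then sn n ((k + 1) * (l + 1)) else sn n ((k + 1) * (n + 2))))"

definition P_even :: "nat \<Rightarrow> real mat" where
  "P_even n = mat1 n n (\<lambda>k l.
     if l = 2 * k \<or> int l = 2 * int k - int n - 1 then 1 else 0)"

definition P_odd :: "nat \<Rightarrow> real mat" where
  "P_odd n = mat1 n n (\<lambda>k l.
     if k = 2 * l \<or> int k = 2 * int l - int n - 2 \<or> (k = n \<and> l = (n + 1) div 2) then 1 else 0)"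

text \<open>In the following, \<open>L\<close> stands for the sequence of the \<open>\<lambda>\<^sub>k\<close> and \<open>ls\<close> for \<open>\<lambda>\<^sub>*\<close>.\<close>

definition F_poly :: "nat \<Rightarrow> (nat \<Rightarrow> real) \<Rightarrow> nat \<Rightarrow> real poly" where
  "F_poly n L N =
     (\<Prod>j = 1..N. [:- L (2 * j + 1), 1:]) +
     Polynomial.smult (4 / (real n + 3))
       (\<Sum>j = 1..N. Polynomial.smult ((sn n (2 * j + 1))\<^sup>2 * (L (2 * j + 1) - L 1))
          (\<Prod>m \<in> {1..N} - {j}. [:- L (2 * m + 1), 1:]))"

definition G_poly :: "nat \<Rightarrow> (nat \<Rightarrow> real) \<Rightarrow> real \<Rightarrow> nat \<Rightarrow> real poly" where
  "G_poly n L ls M =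
     (\<Prod>j = 1..M. [:- L (2 * j), 1:]) +
     Polynomial.smult (4 / (real n + 3))
       (\<Sum>j = 1..M. Polynomial.smult ((sn n (2 * j))\<^sup>2 * (L (2 * j) - ls))
          (\<Prod>m \<in> {1..M} - {j}. [:- L (2 * m), 1:]))"

definition F_mat :: "nat \<Rightarrow> (nat \<Rightarrow> real) \<Rightarrow> nat \<Rightarrow> (nat \<Rightarrow> complex) \<Rightarrow> complex mat" where
  "F_mat n L N \<phi> = mat1 N N (\<lambda>k l.
     of_real ((L (2 * k + 1) - L 1) * sn n (2 * k + 1)) / (of_real (L (2 * k + 1)) - \<phi> l))"

definition G_mat :: "nat \<Rightarrow> (nat \<Rightarrow> real) \<Rightarrow> real \<Rightarrow> nat \<Rightarrow> (nat \<Rightarrow> complex) \<Rightarrow> complex mat" where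
  "G_mat n L ls M \<psi> = mat1 M M (\<lambda>k l.
     of_real ((L (2 * k) - ls) * sn n (2 * k)) / (of_real (L (2 * k)) - \<psi> l))"

definition F_inv :: "nat \<Rightarrow> (nat \<Rightarrow> real) \<Rightarrow> nat \<Rightarrow> (nat \<Rightarrow> complex) \<Rightarrow> complex mat" where
  "F_inv n L N \<phi> = (- 1) ^ N \<cdot>\<^sub>m mat1 N N (\<lambda>k l.
     ((\<Prod>j = 1..N. \<phi> k - of_real (L (2 * j + 1))) *
      (\<Prod>j \<in> {1..N} - {k}. \<phi> j - of_real (L (2 * l + 1)))) /
     (of_real ((L (2 * l + 1) - L 1) * sn n (2 * l + 1)) *
      (\<Prod>j \<in> {1..N} - {k}. \<phi> k - \<phi> j) *
      (\<Prod>j \<in> {1..N} - {l}. of_real (L (2 * l + 1) - L (2 * j + 1)))))"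

definition G_inv :: "nat \<Rightarrow> (nat \<Rightarrow> real) \<Rightarrow> real \<Rightarrow> nat \<Rightarrow> (nat \<Rightarrow> complex) \<Rightarrow> complex mat" where
  "G_inv n L ls M \<psi> = (- 1) ^ M \<cdot>\<^sub>m mat1 M M (\<lambda>k l.
     ((\<Prod>j = 1..M. \<psi> k - of_real (L (2 * j))) *
      (\<Prod>j \<in> {1..M} - {k}. \<psi> j - of_real (L (2 * l)))) /
     (of_real ((L (2 * l) - ls) * sn n (2 * l)) *
      (\<Prod>j \<in> {1..M} - {k}. \<psi> k - \<psi> j) *
      (\<Prod>j \<in> {1..M} - {l}. of_real (L (2 * l) - L (2 * j)))))"

definition diag_powers :: "nat \<Rightarrow> nat \<Rightarrow> (nat \<Rightarrow> complex) \<Rightarrow> (nat \<Rightarrow> complex) \<Rightarrow> int \<Rightarrow> complex mat" where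
  "diag_powers N M \<phi> \<psi> m =
     mat_diag (N + M) (\<lambda>i. if i < N then \<phi> (i + 1) powi m else \<psi> (i - N + 1) powi m)"

end

theory Submission
  imports Defs "Jordan_Normal_Form.Char_Poly"
begin

text \<open>
  \<open>H\<close> is the block of rows \<open>2, \<dots>, n + 1\<close> of the matrix of order \<open>n + 2\<close> that the discrete sine transform diagonalizes
  with eigenvalues \<open>\<lambda>\<^sub>1, \<dots>, \<lambda>\<^sub>n\<^sub>+\<^sub>2\<close>. Orthogonality to the deleted rows 1 and \<open>n + 2\<close> expresses one column of odd index
  and one of even index through the others of the same parity, so that \<open>H = Q (D + \<lambda>\<^sub>0 u u\<^sup>T) Q\<^sup>T\<close> and
  \<open>1 = Q (1 + u u\<^sup>T) Q\<^sup>T\<close> blockwise, with \<open>\<lambda>\<^sub>0\<close> the omitted eigenvalue of the block. Each block thus reduces to a rank one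
  perturbation of a diagonal matrix, whose eigenvector matrix is of Cauchy type. Its eigenvalues are the zeros of
  \<open>\<Sum>\<^sub>l s\<^sub>l\<^sup>2 / (t - \<lambda>\<^sub>l)\<close>, a sum over all indices of one parity with positive weights; hence they are real and simple.
  The inverse of the Cauchy matrix is Lagrange interpolation.
\<close>

text \<open>Row \<open>n + 2\<close> of the sine transform is row 1 with alternating signs, so the
  sum and the difference of the two deleted rows live on the odd and on the even columns; hence one
  linear relation inside each parity class. A cosine times two sines sums to a Toeplitz part plus a
  Hankel part. For the frequencies \<open>n\<close>, ..., \<open>n + 3\<close> of \<open>lam\<close>
  the Toeplitz part only meets the first and last rows and columns, so cutting them leaves a pure
  Hankel matrix. The squared sines of one class sum to \<open>(n + 3) / 4\<close>, whence the
  constant \<open>4 / (n + 3)\<close>. It makes the inverse of \<open>1 + u u\<^sup>T\<close>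
  explicit and turns F and G into the numerators of a sum over all nodes of the class, the dropped
  one included. The obstacle is division by zero: the zeros are given only as complex numbers with
  multiplicity, whereas the matrices divide by differences of a zero and a node and of two zeros.
  That these do not vanish has to be derived; simplicity is where positivity of the weights is
  decisive.\<close>

declare One_nat_def [simp del]

section \<open>Lagrange interpolation and matrices indexed from 1\<close>

text \<open>\<open>h\<close> and its interpolant \<open>g\<close> have degree below the number of
  nodes and agree there. Dividing by the nodal product at \<open>t\<close> gives a partial fraction
  expansion, the form used both for the zeros and for the inverse matrix.\<close>

lemma lagrange_interpolation:
  fixes h :: "'a :: field poly"
  assumes A: "finite A" and inj: "inj_on x A" and deg: "degree h < card A" and t: "t \<notin> x ` A"
  shows "poly h t / (\<Prod>l\<in>A. t - x l) =
    (\<Sum>l\<in>A. poly h (x l) / ((t - x l) * (\<Prod>j\<in>A - {l}. x l - x j)))"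
proof -
  define g where "g = (\<Sum>l\<in>A. Polynomial.smult (poly h (x l) / (\<Prod>j\<in>A - {l}. x l - x j))
    (\<Prod>j\<in>A - {l}. [:- x j, 1:]))"
  have poly_g: "poly g z = (\<Sum>l\<in>A. poly h (x l) / (\<Prod>j\<in>A - {l}. x l - x j) * (\<Prod>j\<in>A - {l}. z - x j))"
    for z by (simp add: g_def poly_sum poly_prod)
  have "h = g"
  proof (rule poly_eqI_degree)
    fix z assume "z \<in> x ` A"
    then obtain i where i: "i \<in> A" "z = x i" by auto
    have "poly g z = (\<Sum>l\<in>A. if l = i then poly h (x l) else 0)"
      unfolding poly_g i
    proof (rule sum.cong[OF refl])
      fix l assume l: "l \<in> A"
      show "poly h (x l) / (\<Prod>j\<in>A - {l}. x l - x j) * (\<Prod>j\<in>A - {l}. x i - x j) =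
        (if l = i then poly h (x l) else 0)"
      proof (cases "l = i")
        case True
        have "(\<Prod>j\<in>A - {l}. x l - x j) \<noteq> 0"
          using A inj l by (auto simp: prod_zero_iff inj_on_eq_iff)
        then show ?thesis using True by simp
      next
        case False
        then have "(\<Prod>j\<in>A - {l}. x i - x j) = 0"
          using A i by (auto simp: prod_zero_iff intro!: bexI[of _ i])
        then show ?thesis using False by simp
      qed
    qed
    then show "poly h z = poly g z" using A i by simp
  next
    show "degree h < card (x ` A)" using deg inj by (simp add: card_image)
    have "degree g \<le> card A - 1"
      unfolding g_def
    proof (rule degree_sum_le[OF A])
      fix l assume l: "l \<in> A"
      have "degree (\<Prod>j\<in>A - {l}. [:- x j, 1:]) = card A - 1"
        using A l by (subst degree_prod_eq_sum_degree) auto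
      then show "degree (Polynomial.smult (poly h (x l) / (\<Prod>j\<in>A - {l}. x l - x j))
          (\<Prod>j\<in>A - {l}. [:- x j, 1:])) \<le> card A - 1"
        by (metis degree_smult_le)
    qed
    then show "degree g < card (x ` A)" using deg inj by (simp add: card_image)
  qed
  then have "poly h t = poly g t" by simp
  then have "poly h t / (\<Prod>l\<in>A. t - x l) =
    (\<Sum>l\<in>A. poly h (x l) / (\<Prod>j\<in>A - {l}. x l - x j) * (\<Prod>j\<in>A - {l}. t - x j) / (\<Prod>l\<in>A. t - x l))"
    unfolding poly_g by (simp only: sum_divide_distrib)
  also have "\<dots> = (\<Sum>l\<in>A. poly h (x l) / ((t - x l) * (\<Prod>j\<in>A - {l}. x l - x j)))"
  proof (rule sum.cong[OF refl])
    fix l assume l: "l \<in> A"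
    have "(\<Prod>j\<in>A - {l}. t - x j) \<noteq> 0" using A t by (auto simp: prod_zero_iff)
    then show "poly h (x l) / (\<Prod>j\<in>A - {l}. x l - x j) * (\<Prod>j\<in>A - {l}. t - x j) / (\<Prod>l\<in>A. t - x l) =
      poly h (x l) / ((t - x l) * (\<Prod>j\<in>A - {l}. x l - x j))"
      using prod.remove[OF A l, of "\<lambda>l. t - x l"] by simp
  qed
  finally show ?thesis .
qed

lemma mat1_carrier [simp]: "mat1 r c f \<in> carrier_mat r c"
  by (simp add: mat1_def)

lemma dim_mat1 [simp]: "dim_row (mat1 r c f) = r" "dim_col (mat1 r c f) = c"
  by (simp_all add: mat1_def)

lemma mat1_eqI:
  assumes "\<And>i j. i \<in> {1..r} \<Longrightarrow> j \<in> {1..c} \<Longrightarrow> f i j = g i j"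
  shows "mat1 r c f = mat1 r c g"
  using assms by (auto simp: mat1_def)

lemma mat1_mult: "mat1 r n f * mat1 n c g = mat1 r c (\<lambda>i j. \<Sum>k = 1..n. f i k * g k j)"
proof -
  have "(\<Sum>k\<in>{0..<n}. f i (k + 1) * g (k + 1) j) = (\<Sum>k = 1..n. f i k * g k j)" for i j
    by (rule sum.reindex_bij_witness[of _ "\<lambda>k. k - 1" "\<lambda>k. k + 1"]) auto
  then show ?thesis by (intro eq_matI) (auto simp: mat1_def scalar_prod_def)
qed

lemma mat1_add: "mat1 r c f + mat1 r c g = mat1 r c (\<lambda>i j. f i j + g i j)"
  by (intro eq_matI) (auto simp: mat1_def)

lemma smult_mat1: "a \<cdot>\<^sub>m mat1 r c f = mat1 r c (\<lambda>i j. a * f i j)"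
  by (intro eq_matI) (auto simp: mat1_def)

lemma transpose_mat1: "transpose_mat (mat1 r c f) = mat1 c r (\<lambda>i j. f j i)"
  by (intro eq_matI) (auto simp: mat1_def)

lemma map_mat1: "map_mat h (mat1 r c f) = mat1 r c (\<lambda>i j. h (f i j))"
  by (intro eq_matI) (auto simp: mat1_def)

lemma one_mat1: "1\<^sub>m n = mat1 n n (\<lambda>i j. if i = j then 1 else 0)"
  by (intro eq_matI) (auto simp: mat1_def)

lemma mat_diag_mat1: "mat_diag n (\<lambda>i. f (i + 1)) = mat1 n n (\<lambda>i j. if i = j then f j else 0)"
  by (intro eq_matI) (auto simp: mat1_def mat_diag_def)

text \<open>Common form of \<open>F_poly\<close> and \<open>G_poly\<close>. By the determinant of a
  rank one update it is, for nonzero \<open>s 0\<close>, the characteristic polynomial of the matrix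
  \<open>B\<close> in \<open>cauchy_diagonalizes\<close>.\<close>

definition secular_poly :: "real \<Rightarrow> (nat \<Rightarrow> real) \<Rightarrow> (nat \<Rightarrow> real) \<Rightarrow> nat \<Rightarrow> real poly" where
  "secular_poly \<kappa> \<mu> s N =
     (\<Prod>j = 1..N. [:- \<mu> j, 1:]) +
     Polynomial.smult \<kappa> (\<Sum>j = 1..N. Polynomial.smult ((s j)\<^sup>2 * (\<mu> j - \<mu> 0))
       (\<Prod>m \<in> {1..N} - {j}. [:- \<mu> m, 1:]))"

section \<open>Rank one perturbations of diagonal matrices\<close>

text \<open>Index 0 belongs to the eigenvalue \<open>\<mu> 0\<close> whose column is dropped; the remaining columns carry
  the vector \<open>u i = s i / s 0\<close>.\<close>

definition gram :: "nat \<Rightarrow> (nat \<Rightarrow> real) \<Rightarrow> (nat \<Rightarrow> real) \<Rightarrow> real mat" where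
  "gram N s f = mat1 N N (\<lambda>i j. (if i = j then f j else 0) + f 0 * (s i / s 0) * (s j / s 0))"

lemma gram_carrier [simp]: "gram N s f \<in> carrier_mat N N"
  by (simp add: gram_def)

lemma sum_kronecker_right:
  fixes N :: nat
  shows "j \<in> {1..N} \<Longrightarrow> (\<Sum>k = 1..N. (a k :: 'a :: comm_ring_1) * (if k = j then b k else 0)) = a j * b j"
  by (simp add: if_distrib[of "\<lambda>z. _ * z"] cong: if_cong)

lemma sum_kronecker_left:
  fixes N :: nat
  shows "i \<in> {1..N} \<Longrightarrow> (\<Sum>k = 1..N. (if i = k then b k else 0) * (a k :: 'a :: comm_ring_1)) = b i * a i"
  by (simp add: if_distrib[of "\<lambda>z. z * _"] cong: if_cong)

text \<open>\<open>weights\<close> and \<open>inj\<close> include node 0. The zeros are assumed only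
  as a complex enumeration with multiplicity; reality, simplicity and disjointness from the nodes
  are consequences.\<close>

locale secular_block =
  fixes N :: nat and \<kappa> :: real and \<mu> s :: "nat \<Rightarrow> real" and \<phi> :: "nat \<Rightarrow> complex"
  assumes weights: "\<kappa> * (\<Sum>j\<le>N. (s j)\<^sup>2) = 1"
    and inj: "inj_on \<mu> {..N}"
    and s_nz: "\<And>j. j \<le> N \<Longrightarrow> s j \<noteq> 0"
    and zeros: "lists_zeros (secular_poly \<kappa> \<mu> s N) N \<phi>"
begin

abbreviation x :: "nat \<Rightarrow> complex" where "x j \<equiv> complex_of_real (\<mu> j)"

definition P :: "complex poly" where "P = map_poly of_real (secular_poly \<kappa> \<mu> s N)"

lemma atMost_minus_0: "{..N} - {0} = {1..N}"
  by auto

lemma kappa_nz: "\<kappa> \<noteq> 0"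
  using weights by auto

text \<open>With \<open>\<kappa> * (\<Sum>j\<le>N. (s j)\<^sup>2) = 1\<close> the dropped node enters on the same footing as the others: the polynomial
  is \<open>\<kappa> * (\<Sum>l\<le>N. (s l)\<^sup>2 * (\<Prod>j\<noteq>l. t - \<mu> j))\<close> over all nodes \<open>0, \<dots>, N\<close>.\<close>

lemma poly_secular_node:
  assumes l: "l \<le> N"
  shows "poly (secular_poly \<kappa> \<mu> s N) (\<mu> l) = \<kappa> * (s l)\<^sup>2 * (\<Prod>j\<in>{..N} - {l}. \<mu> l - \<mu> j)"
proof (cases "l = 0")
  case False
  with l have l1: "l \<in> {1..N}" by auto
  have "(\<Sum>j = 1..N. (s j)\<^sup>2 * (\<mu> j - \<mu> 0) * (\<Prod>m\<in>{1..N} - {j}. \<mu> l - \<mu> m)) =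
    (\<Sum>j = 1..N. if j = l then (s l)\<^sup>2 * (\<mu> l - \<mu> 0) * (\<Prod>m\<in>{1..N} - {l}. \<mu> l - \<mu> m) else 0)"
    using l1 by (intro sum.cong) (auto simp: prod_zero_iff)
  moreover have "(\<Prod>j = 1..N. \<mu> l - \<mu> j) = 0" using l1 by (auto simp: prod_zero_iff)
  moreover have "(\<Prod>j\<in>{..N} - {l}. \<mu> l - \<mu> j) = (\<mu> l - \<mu> 0) * (\<Prod>m\<in>{1..N} - {l}. \<mu> l - \<mu> m)"
  proof -
    have "{..N} - {l} - {0} = {1..N} - {l}" by auto
    then show ?thesis using prod.remove[of "{..N} - {l}" 0 "\<lambda>j. \<mu> l - \<mu> j"] False by simp
  qed
  ultimately show ?thesis
    using l1 by (simp add: secular_poly_def poly_sum poly_prod)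
next
  case True
  \<comment> \<open>The factor \<open>\<mu> j - \<mu> 0\<close> is, up to sign, the one missing from
    the product, so all summands are multiples of the same full product.\<close>
  have "(s j)\<^sup>2 * (\<mu> j - \<mu> 0) * (\<Prod>m\<in>{1..N} - {j}. \<mu> 0 - \<mu> m) = - (s j)\<^sup>2 * (\<Prod>m = 1..N. \<mu> 0 - \<mu> m)"
    if "j \<in> {1..N}" for j
    by (subst prod.remove[of "{1..N}" j]) (use that in \<open>simp_all add: algebra_simps\<close>)
  then have "(\<Sum>j = 1..N. (s j)\<^sup>2 * (\<mu> j - \<mu> 0) * (\<Prod>m\<in>{1..N} - {j}. \<mu> 0 - \<mu> m)) =
    - (\<Sum>j = 1..N. (s j)\<^sup>2) * (\<Prod>m = 1..N. \<mu> 0 - \<mu> m)"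
    by (simp add: sum_distrib_right sum_negf)
  then have "poly (secular_poly \<kappa> \<mu> s N) (\<mu> 0) = (1 - \<kappa> * (\<Sum>j = 1..N. (s j)\<^sup>2)) * (\<Prod>m = 1..N. \<mu> 0 - \<mu> m)"
    by (simp add: secular_poly_def poly_sum poly_prod algebra_simps)
  \<comment> \<open>Removing the nodes 1, ..., N from the total weight 1 leaves the weight of node
    0.\<close>
  also have "1 - \<kappa> * (\<Sum>j = 1..N. (s j)\<^sup>2) = \<kappa> * (s 0)\<^sup>2"
    using weights sum.remove[of "{..N}" 0 "\<lambda>j. (s j)\<^sup>2"] by (simp add: atMost_minus_0 algebra_simps)
  finally show ?thesis using True by (simp add: atMost_minus_0)
qed

lemma poly_P_node:
  assumes "l \<le> N"
  shows "poly P (x l) = of_real (\<kappa> * (s l)\<^sup>2) * (\<Prod>j\<in>{..N} - {l}. x l - x j)"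
  using poly_secular_node[OF assms] by (simp add: P_def of_real_hom.poly_map_poly)

lemma poly_P_node_nz:
  assumes "l \<le> N"
  shows "poly P (x l) \<noteq> 0"
  using assms inj s_nz kappa_nz by (auto simp: poly_P_node prod_zero_iff inj_on_eq_iff)

lemma P_nz: "P \<noteq> 0"
  using poly_P_node_nz[of 0] by auto

text \<open>Over the complex numbers the multiset of roots fixes \<open>P\<close> up to its leading
  coefficient, which stays symbolic; the degree is then read off from the number of listed
  zeros.\<close>

lemma P_factor: "P = Polynomial.smult (lead_coeff P) (\<Prod>k = 1..N. [:- \<phi> k, 1:])"
proof -
  have "P = Polynomial.smult (lead_coeff P) (\<Prod>z\<in>#image_mset \<phi> (mset_set {1..N}). [:- z, 1:])"
    using zeros unfolding lists_zeros_def P_def[symmetric]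
    by (simp only: complex_poly_decompose_multiset)
  also have "(\<Prod>z\<in>#image_mset \<phi> (mset_set {1..N}). [:- z, 1:]) = (\<Prod>k = 1..N. [:- \<phi> k, 1:])"
    by (simp add: prod_unfold_prod_mset image_mset.compositionality comp_def)
  finally show ?thesis .
qed

lemma poly_P: "poly P t = lead_coeff P * (\<Prod>k = 1..N. t - \<phi> k)"
  by (subst P_factor) (simp add: poly_prod)

lemma degree_P: "degree P = N"
  using P_nz by (subst P_factor) (simp add: degree_prod_eq_sum_degree)

text \<open>\<open>P\<close> vanishes at each zero but at no node. This keeps the denominators of
  the Cauchy matrix and of the secular equation away from 0.\<close>

lemma phi_not_node:
  assumes "k \<in> {1..N}" "l \<le> N"
  shows "\<phi> k \<noteq> x l" "x l \<noteq> \<phi> k"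
proof -
  have "poly P (\<phi> k) = 0" using assms(1) by (auto simp: poly_P prod_zero_iff)
  then show "\<phi> k \<noteq> x l" "x l \<noteq> \<phi> k" using poly_P_node_nz[OF assms(2)] by auto
qed

lemma inj_x: "A \<subseteq> {..N} \<Longrightarrow> inj_on x A"
  using inj by (auto simp: inj_on_def)

text \<open>Node 0 brings the number of nodes to \<open>N + 1\<close>, enough to interpolate
  \<open>P\<close> itself, of degree \<open>N\<close>.\<close>

lemma lagrange_nodes:
  assumes "degree h \<le> N" "\<And>l. l \<le> N \<Longrightarrow> t \<noteq> x l"
  shows "poly h t / (\<Prod>l\<le>N. t - x l) =
    (\<Sum>l\<le>N. poly h (x l) / ((t - x l) * (\<Prod>j\<in>{..N} - {l}. x l - x j)))"
  using assms by (intro lagrange_interpolation inj_x) auto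

lemma node_prod_nz: "l \<le> N \<Longrightarrow> (\<Prod>j\<in>{..N} - {l}. x l - x j) \<noteq> 0"
  using inj by (auto simp: prod_zero_iff inj_on_eq_iff)

text \<open>At a zero of \<open>P\<close> its partial fraction expansion over all nodes vanishes,
  and by \<open>poly_P_node\<close> the residues are
  \<open>\<kappa> * (s l)\<^sup>2\<close>.\<close>

lemma secular_equation:
  assumes k: "k \<in> {1..N}"
  shows "(\<Sum>l\<le>N. of_real ((s l)\<^sup>2) / (\<phi> k - x l)) = 0"
proof -
  have "poly P (\<phi> k) = 0" using k by (auto simp: poly_P prod_zero_iff)
  then have "0 = poly P (\<phi> k) / (\<Prod>l\<le>N. \<phi> k - x l)" by simp
  also have "\<dots> = (\<Sum>l\<le>N. poly P (x l) / ((\<phi> k - x l) * (\<Prod>j\<in>{..N} - {l}. x l - x j)))"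
    using phi_not_node(1)[OF k] by (intro lagrange_nodes) (auto simp: degree_P)
  also have "\<dots> = of_real \<kappa> * (\<Sum>l\<le>N. of_real ((s l)\<^sup>2) / (\<phi> k - x l))"
    unfolding sum_distrib_left using node_prod_nz by (intro sum.cong) (simp_all add: poly_P_node)
  finally show ?thesis using kappa_nz by simp
qed

text \<open>The imaginary part of \<open>1 / (\<phi> k - x l)\<close> is
  \<open>- Im (\<phi> k)\<close> over a squared modulus, so positive weights in the secular equation
  force \<open>Im (\<phi> k) = 0\<close>.\<close>

lemma phi_real:
  assumes k: "k \<in> {1..N}"
  shows "Im (\<phi> k) = 0"
proof -
  define S where "S = (\<Sum>l\<le>N. (s l)\<^sup>2 / (cmod (\<phi> k - x l))\<^sup>2)"
  have "(s l)\<^sup>2 / (cmod (\<phi> k - x l))\<^sup>2 > 0" if "l \<le> N" for l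
    using s_nz[OF that] phi_not_node(1)[OF k that] by simp
  then have S: "S > 0" unfolding S_def by (intro sum_pos) auto
  have "0 = Im (\<Sum>l\<le>N. of_real ((s l)\<^sup>2) / (\<phi> k - x l))"
    by (simp only: secular_equation[OF k] zero_complex.sel)
  also have "\<dots> = - Im (\<phi> k) * S"
    unfolding S_def sum_distrib_left Im_sum
    by (intro sum.cong refl) (simp add: cmod_power2 Im_divide del: of_real_power)
  finally show ?thesis using S by simp
qed

text \<open>A double zero would be a zero of \<open>P / (t - \<phi> k)\<close>; interpolating this polynomial at the nodes turns that
  into the vanishing of a sum of positive terms.\<close>

lemma phi_distinct:
  assumes i: "i \<in> {1..N}" and k: "k \<in> {1..N}" and ik: "i \<noteq> k"
  shows "\<phi> i \<noteq> \<phi> k"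
proof
  assume eq: "\<phi> i = \<phi> k"
  obtain r where r: "\<phi> k = of_real r" using phi_real[OF k] by (metis complex_is_Real_iff Reals_cases)
  define h where "h = (\<Prod>j\<in>{1..N} - {k}. [:- \<phi> j, 1:])"
  have h: "lead_coeff P * (t - \<phi> k) * poly h t = poly P t" for t
    using k prod.remove[of "{1..N}" k "\<lambda>j. t - \<phi> j"] by (simp add: poly_P h_def poly_prod)
  have "degree h \<le> N"
    unfolding h_def using k by (subst degree_prod_eq_sum_degree) auto
  \<comment> \<open>The factor of index \<open>i\<close> survives in \<open>h\<close> and vanishes
    because \<open>\<phi> i = \<phi> k\<close>.\<close>
  moreover have "poly h (\<phi> k) = 0"
    using i ik unfolding h_def poly_prod by (intro prod_zero) (auto intro!: bexI[of _ i] simp: eq)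
  ultimately have "0 = lead_coeff P * (\<Sum>l\<le>N. poly h (x l) / ((\<phi> k - x l) * (\<Prod>j\<in>{..N} - {l}. x l - x j)))"
    using lagrange_nodes[of h "\<phi> k"] phi_not_node(1)[OF k] by simp
  \<comment> \<open>Up to the factor \<open>\<kappa>\<close>, this is the derivative of the secular
    sum at the real point \<open>r\<close>; reality is what makes the squares positive.\<close>
  also have "\<dots> = of_real (- \<kappa> * (\<Sum>l\<le>N. (s l)\<^sup>2 / (r - \<mu> l)\<^sup>2))"
    unfolding sum_distrib_left of_real_sum
  proof (intro sum.cong refl)
    fix l assume "l \<in> {..N}"
    then have l: "l \<le> N" by simp
    have "lead_coeff P * poly h (x l) = poly P (x l) / (x l - \<phi> k)"
      using phi_not_node[OF k l] by (simp flip: h)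
    then have "lead_coeff P * (poly h (x l) / ((\<phi> k - x l) * (\<Prod>j\<in>{..N} - {l}. x l - x j))) =
        of_real (\<kappa> * (s l)\<^sup>2) / ((x l - \<phi> k) * (\<phi> k - x l))"
      using node_prod_nz[OF l] by (simp add: poly_P_node[OF l])
    also have "\<dots> = of_real (- \<kappa> * ((s l)\<^sup>2 / (r - \<mu> l)\<^sup>2))"
    proof -
      have "(x l - \<phi> k) * (\<phi> k - x l) = - of_real ((r - \<mu> l)\<^sup>2)"
        by (simp add: r algebra_simps power2_eq_square)
      then show ?thesis by simp
    qed
    finally show "lead_coeff P * (poly h (x l) / ((\<phi> k - x l) * (\<Prod>j\<in>{..N} - {l}. x l - x j))) =
      of_real (- \<kappa> * ((s l)\<^sup>2 / (r - \<mu> l)\<^sup>2))" .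
  qed
  finally have "- \<kappa> * (\<Sum>l\<le>N. (s l)\<^sup>2 / (r - \<mu> l)\<^sup>2) = 0" by (metis of_real_eq_0_iff)
  then have "(\<Sum>l\<le>N. (s l)\<^sup>2 / (r - \<mu> l)\<^sup>2) = 0" using kappa_nz by simp
  moreover have "(s l)\<^sup>2 / (r - \<mu> l)\<^sup>2 > 0" if "l \<le> N" for l
    using s_nz[OF that] phi_not_node(1)[OF k that] r by simp
  then have "(\<Sum>l\<le>N. (s l)\<^sup>2 / (r - \<mu> l)\<^sup>2) > 0" by (intro sum_pos) auto
  ultimately show False by simp
qed


section \<open>The Cauchy matrix of eigenvectors and its inverse\<close>

text \<open>Column \<open>l\<close> is the resolvent of the diagonal matrix at
  \<open>\<phi> l\<close> applied to the vector \<open>(\<mu> k - \<mu> 0) * s k\<close>, the usual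
  eigenvector of a diagonal plus rank one matrix.\<close>

definition cauchy_mat :: "complex mat" where
  "cauchy_mat = mat1 N N (\<lambda>k l. of_real ((\<mu> k - \<mu> 0) * s k) / (x k - \<phi> l))"

definition cauchy_inv :: "complex mat" where
  "cauchy_inv = (- 1) ^ N \<cdot>\<^sub>m mat1 N N (\<lambda>k l.
     ((\<Prod>j = 1..N. \<phi> k - x j) * (\<Prod>j \<in> {1..N} - {k}. \<phi> j - x l)) /
     (of_real ((\<mu> l - \<mu> 0) * s l) * (\<Prod>j \<in> {1..N} - {k}. \<phi> k - \<phi> j) *
      (\<Prod>j \<in> {1..N} - {l}. x l - x j)))"

lemma cauchy_carrier [simp]: "cauchy_mat \<in> carrier_mat N N" "cauchy_inv \<in> carrier_mat N N"
  by (simp_all add: cauchy_mat_def cauchy_inv_def)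

text \<open>In row \<open>k\<close> against column \<open>m\<close> the factors
  \<open>(\<mu> l - \<mu> 0) * s l\<close> cancel, and what remains is the partial fraction
  expansion of \<open>h / q\<close> at \<open>\<phi> m\<close> over the nodes 1, ..., N. Since
  \<open>h\<close> has all zeros but \<open>\<phi> k\<close>, this vanishes unless
  \<open>m = k\<close>.\<close>

lemma cauchy_inv_cauchy: "cauchy_inv * cauchy_mat = 1\<^sub>m N"
  unfolding cauchy_inv_def cauchy_mat_def smult_mat1 mat1_mult one_mat1
proof (rule mat1_eqI)
  fix k m assume k: "k \<in> {1..N}" and m: "m \<in> {1..N}"
  define h where "h = (\<Prod>j\<in>{1..N} - {k}. [:- \<phi> j, 1:])"
  define D where "D = (\<Prod>j \<in> {1..N} - {k}. \<phi> k - \<phi> j)"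
  define q where "q t = (\<Prod>j = 1..N. t - x j)" for t
  have h: "poly h t = (\<Prod>j\<in>{1..N} - {k}. t - \<phi> j)" for t
    by (simp add: h_def poly_prod)
  have D: "D \<noteq> 0" using phi_distinct k by (auto simp: D_def prod_zero_iff)
  have q: "q (\<phi> m) \<noteq> 0" using phi_not_node(1)[OF m] by (auto simp: q_def prod_zero_iff)
  \<comment> \<open>The product has \<open>N - 1\<close> factors, so the prefactor leaves one minus
    sign, spent on turning \<open>x l - \<phi> m\<close> into \<open>\<phi> m - x l\<close>.\<close>
  have sgn: "(- 1) ^ N * (\<Prod>j \<in> {1..N} - {k}. \<phi> j - x l) = - poly h (x l)" for l
  proof -
    have "(\<Prod>j \<in> {1..N} - {k}. \<phi> j - x l) = (\<Prod>j \<in> {1..N} - {k}. - 1 * (x l - \<phi> j))" by simp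
    also have "\<dots> = (- 1) ^ (N - 1) * poly h (x l)"
      using k by (subst prod.distrib) (simp add: h)
    finally show ?thesis using k by (cases N) auto
  qed
  have "degree h < card {1..N}" unfolding h_def using k by (subst degree_prod_eq_sum_degree) auto
  then have L: "poly h (\<phi> m) / q (\<phi> m) =
    (\<Sum>l = 1..N. poly h (x l) / ((\<phi> m - x l) * (\<Prod>j\<in>{1..N} - {l}. x l - x j)))"
    unfolding q_def using phi_not_node(1)[OF m] by (intro lagrange_interpolation inj_x) force+
  have "(\<Sum>l = 1..N. (- 1) ^ N * (q (\<phi> k) * (\<Prod>j \<in> {1..N} - {k}. \<phi> j - x l) /
      (of_real ((\<mu> l - \<mu> 0) * s l) * D * (\<Prod>j \<in> {1..N} - {l}. x l - x j))) *
      (of_real ((\<mu> l - \<mu> 0) * s l) / (x l - \<phi> m))) =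
    q (\<phi> k) / D * (poly h (\<phi> m) / q (\<phi> m))"
    unfolding L sum_distrib_left
  proof (intro sum.cong refl)
    fix l assume l: "l \<in> {1..N}"
    define c where "c = complex_of_real ((\<mu> l - \<mu> 0) * s l)"
    define d where "d = (\<Prod>j \<in> {1..N} - {l}. x l - x j)"
    have c: "c \<noteq> 0" using l s_nz[of l] inj_on_eq_iff[OF inj, of l 0] by (auto simp: c_def)
    have "(- 1) ^ N * (q (\<phi> k) * (\<Prod>j \<in> {1..N} - {k}. \<phi> j - x l) / (c * D * d)) * (c / (x l - \<phi> m)) =
      ((- 1) ^ N * (\<Prod>j \<in> {1..N} - {k}. \<phi> j - x l)) * (q (\<phi> k) / (c * D * d)) * (c / (x l - \<phi> m))"
      by simp
    also have "\<dots> = q (\<phi> k) / D * (poly h (x l) / ((\<phi> m - x l) * d))"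
    proof -
      define y where "y = \<phi> m - x l"
      have "x l - \<phi> m = - y" by (simp add: y_def)
      then show ?thesis unfolding sgn y_def[symmetric] using c by (simp add: mult_ac)
    qed
    finally show "(- 1) ^ N * (q (\<phi> k) * (\<Prod>j \<in> {1..N} - {k}. \<phi> j - x l) / (c * D * d)) * (c / (x l - \<phi> m)) =
      q (\<phi> k) / D * (poly h (x l) / ((\<phi> m - x l) * d))" .
  qed
  also have "\<dots> = (if k = m then 1 else 0)"
  proof (cases "k = m")
    case True
    then show ?thesis using D q by (simp add: D_def h)
  next
    case False
    then have "poly h (\<phi> m) = 0" unfolding h using m by (intro prod_zero) (auto intro!: bexI[of _ m])
    then show ?thesis using False by simp
  qed
  finally show "(\<Sum>l = 1..N. (- 1) ^ N * ((\<Prod>j = 1..N. \<phi> k - x j) * (\<Prod>j \<in> {1..N} - {k}. \<phi> j - x l) /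
      (of_real ((\<mu> l - \<mu> 0) * s l) * (\<Prod>j \<in> {1..N} - {k}. \<phi> k - \<phi> j) * (\<Prod>j \<in> {1..N} - {l}. x l - x j))) *
      (of_real ((\<mu> l - \<mu> 0) * s l) / (x l - \<phi> m))) = (if k = m then 1 else 0)"
    unfolding D_def q_def .
qed

lemma cauchy_cauchy_inv: "cauchy_mat * cauchy_inv = 1\<^sub>m N"
  using cauchy_inv_cauchy by (rule mat_mult_left_right_inverse[rotated 2]) simp_all

text \<open>An intermediate matrix \<open>B\<close> separates two facts: the columns of
  \<open>cauchy_mat\<close> are eigenvectors of \<open>B\<close>, and \<open>B\<close> carries the
  Gram matrix of 1 to that of \<open>\<mu>\<close>.\<close>

lemma cauchy_diagonalizes:
  "cauchy_mat * mat_diag N (\<lambda>i. \<phi> (i + 1)) * cauchy_inv * cmat (gram N s (\<lambda>_. 1)) = cmat (gram N s \<mu>)"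
proof -
  \<comment> \<open>With \<open>u i = s i / s 0\<close>, \<open>weights\<close> says
    \<open>1 + u\<^sup>T u = 1 / (\<kappa> * (s 0)\<^sup>2)\<close>. So \<open>w\<close> is
    \<open>u\<close> divided by \<open>1 + u\<^sup>T u\<close>, that is, the row
    \<open>u\<^sup>T\<close> times the inverse of \<open>1 + u u\<^sup>T\<close>.\<close>
  define w where "w i = \<kappa> * s 0 * s i" for i
  \<comment> \<open>\<open>B\<close> is \<open>gram N s \<mu>\<close> times the inverse of \<open>gram N s (\<lambda>_. 1)\<close>, by the Sherman-Morrison formula.\<close>
  define B where "B = cmat (mat1 N N (\<lambda>i j. (if i = j then \<mu> j else 0) + (\<mu> 0 - \<mu> i) * (s i / s 0) * w j))"
  have B: "B \<in> carrier_mat N N" by (simp add: B_def)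
  have s0: "s 0 \<noteq> 0" using s_nz by simp
  have sw: "\<kappa> * (\<Sum>k = 1..N. (s k)\<^sup>2) = 1 - \<kappa> * (s 0)\<^sup>2"
    using weights sum.remove[of "{..N}" 0 "\<lambda>j. (s j)\<^sup>2"] by (simp add: atMost_minus_0 algebra_simps)
  have "B * cauchy_mat = cauchy_mat * mat_diag N (\<lambda>i. \<phi> (i + 1))"
    unfolding B_def cauchy_mat_def mat_diag_mat1 map_mat1 mat1_mult
  proof (rule mat1_eqI)
    fix i j assume i: "i \<in> {1..N}" and j: "j \<in> {1..N}"
    define f where "f k = of_real ((\<mu> k - \<mu> 0) * s k) / (x k - \<phi> j)" for k
    \<comment> \<open>Splitting \<open>\<mu> k - \<mu> 0\<close> as
      \<open>(x k - \<phi> j) + (\<phi> j - x 0)\<close> reduces the sum to \<open>weights\<close>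
      and the secular equation; its value \<open>s 0\<close> is the same for every
      eigenvector.\<close>
    have tm: "of_real (w k) * f k = of_real (\<kappa> * s 0) * of_real ((s k)\<^sup>2) 
      + of_real (\<kappa> * s 0) * (x 0 - \<phi> j) * (of_real ((s k)\<^sup>2) / (\<phi> j - x k))" 
      if "k \<in> {1..N}" for k
      using phi_not_node[OF j, of k] that unfolding f_def w_def
      by (simp add: field_simps power2_eq_square)
    have se: "(\<Sum>k = 1..N. of_real ((s k)\<^sup>2) / (\<phi> j - x k)) = - of_real ((s 0)\<^sup>2) / (\<phi> j - x 0)"
      using secular_equation[OF j] sum.remove[of "{..N}" 0 "\<lambda>k. of_real ((s k)\<^sup>2) / (\<phi> j - x k)"]
      by (simp add: atMost_minus_0 add_eq_0_iff2 del: of_real_power)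
    have "(\<Sum>k = 1..N. of_real (w k) * f k) = of_real (\<kappa> * s 0) * (\<Sum>k = 1..N. of_real ((s k)\<^sup>2))
      + of_real (\<kappa> * s 0) * (x 0 - \<phi> j) * (\<Sum>k = 1..N. of_real ((s k)\<^sup>2) / (\<phi> j - x k))"
      unfolding sum_distrib_left sum.distrib[symmetric] by (intro sum.cong refl tm)
    also have "\<dots> = of_real (s 0 * (\<kappa> * (\<Sum>k = 1..N. (s k)\<^sup>2)) + \<kappa> * (s 0)^3)"
      unfolding se using phi_not_node[OF j, of 0]
      by (simp add: field_simps power2_eq_square power3_eq_cube)
    also have "\<dots> = of_real (s 0)"
      unfolding sw by (simp add: algebra_simps power2_eq_square power3_eq_cube)
    finally have wf: "(\<Sum>k = 1..N. of_real (w k) * f k) = of_real (s 0)" .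
    have "(\<Sum>k = 1..N. of_real ((if i = k then \<mu> k else 0) + (\<mu> 0 - \<mu> i) * (s i / s 0) * w k) * f k) =
      (\<Sum>k = 1..N. (if i = k then x k else 0) * f k) + of_real ((\<mu> 0 - \<mu> i) * (s i / s 0)) * (\<Sum>k = 1..N. of_real (w k) * f k)"
      unfolding sum_distrib_left sum.distrib[symmetric]
      by (intro sum.cong refl) (simp add: algebra_simps)
    also have "\<dots> = x i * f i + of_real ((\<mu> 0 - \<mu> i) * s i)"
      unfolding wf using i s0 by (subst sum_kronecker_left) auto
    \<comment> \<open>By definition \<open>f i * (x i - \<phi> j)\<close> is
      \<open>(\<mu> i - \<mu> 0) * s i\<close>, so the rank one term trades \<open>x i\<close> for
      \<open>\<phi> j\<close>.\<close>
    also have "\<dots> = f i * \<phi> j"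
      unfolding f_def using phi_not_node[OF j, of i] i by (simp add: field_simps)
    also have "\<dots> = (\<Sum>k = 1..N. of_real ((\<mu> i - \<mu> 0) * s i) / (x i - \<phi> k) * (if k = j then \<phi> k else 0))"
      using j by (subst sum_kronecker_right) (auto simp: f_def)
    finally show "(\<Sum>k = 1..N. of_real ((if i = k then \<mu> k else 0) + (\<mu> 0 - \<mu> i) * (s i / s 0) * w k) *
        (of_real ((\<mu> k - \<mu> 0) * s k) / (x k - \<phi> j))) =
      (\<Sum>k = 1..N. of_real ((\<mu> i - \<mu> 0) * s i) / (x i - \<phi> k) * (if k = j then \<phi> j else 0))"
      unfolding f_def by (simp cong: if_cong)
  qed
  then have "cauchy_mat * mat_diag N (\<lambda>i. \<phi> (i + 1)) * cauchy_inv = B * cauchy_mat * cauchy_inv" by simp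
  also have "\<dots> = B" using B by (simp add: assoc_mult_mat[of _ N N _ N _ N] cauchy_cauchy_inv)
  finally have *: "cauchy_mat * mat_diag N (\<lambda>i. \<phi> (i + 1)) * cauchy_inv = B" .
  have "mat1 N N (\<lambda>i j. (if i = j then \<mu> j else 0) + (\<mu> 0 - \<mu> i) * (s i / s 0) * w j) * gram N s (\<lambda>_. 1) = gram N s \<mu>"
    unfolding gram_def mat1_mult
  proof (rule mat1_eqI)
    fix i j assume i: "i \<in> {1..N}" and j: "j \<in> {1..N}"
    define c where "c = (\<mu> 0 - \<mu> i) * (s i / s 0)"
    define u where "u k = s k / s 0" for k
    have "(\<Sum>k = 1..N. ((if i = k then \<mu> k else 0) + c * w k) * ((if k = j then 1 else 0) + u k * u j)) =
       (\<Sum>k = 1..N. (if i = k then \<mu> k else 0) * ((if k = j then 1 else 0) + u k * u j))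
       + c * ((\<Sum>k = 1..N. w k * (if k = j then 1 else 0)) + (\<Sum>k = 1..N. w k * u k) * u j)"
      unfolding sum_distrib_left sum_distrib_right sum.distrib[symmetric]
      by (intro sum.cong refl) (simp add: algebra_simps)
    also have "(\<Sum>k = 1..N. w k * u k) = \<kappa> * (\<Sum>k = 1..N. (s k)\<^sup>2)"
      using s0 by (simp add: w_def u_def sum_distrib_left power2_eq_square mult.assoc)
    also have "(\<Sum>k = 1..N. w k * (if k = j then 1 else 0)) = w j"
      using j by (subst sum_kronecker_right) auto
    also have "(\<Sum>k = 1..N. (if i = k then \<mu> k else 0) * ((if k = j then 1 else 0) + u k * u j)) =
      \<mu> i * ((if i = j then 1 else 0) + u i * u j)"
      using i by (subst sum_kronecker_left) auto
    \<comment> \<open>In vector form: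
      \<open>w\<^sup>T (1 + u u\<^sup>T) = u\<^sup>T\<close>.\<close>
    also have "w j + \<kappa> * (\<Sum>k = 1..N. (s k)\<^sup>2) * u j = u j"
      unfolding sw using s0 by (simp add: w_def u_def field_simps power2_eq_square)
    also have "\<mu> i * ((if i = j then 1 else 0) + u i * u j) + c * u j =
      (if i = j then \<mu> j else 0) + \<mu> 0 * u i * u j"
      by (auto simp: c_def u_def algebra_simps diff_divide_distrib)
    finally show "(\<Sum>k = 1..N. ((if i = k then \<mu> k else 0) + (\<mu> 0 - \<mu> i) * (s i / s 0) * w k) *
        ((if k = j then 1 else 0) + 1 * (s k / s 0) * (s j / s 0))) =
      (if i = j then \<mu> j else 0) + \<mu> 0 * (s i / s 0) * (s j / s 0)"
      unfolding c_def u_def by simp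
  qed
  then show ?thesis
    unfolding * B_def by (simp flip: of_real_hom.mat_hom_mult[of _ N N _ N])
qed

end

section \<open>Sums of sines\<close>

text \<open>Either all terms are 1, or multiplication by \<open>2 * sin \<beta>\<close>, with
  \<open>\<beta>\<close> half the step, makes the sum telescope. The full period matters: over
  \<open>j < K\<close> an odd \<open>m\<close> would leave the value 1.\<close>

lemma cos_sum_period:
  fixes m :: int
  assumes K: "K > 0"
  shows "(\<Sum>j<2 * K. cos (of_int m * real j * pi / real K)) = (if int (2 * K) dvd m then 2 * real K else 0)"
proof (cases "int (2 * K) dvd m")
  case True
  then obtain q where q: "m = int (2 * K) * q" ..
  have "cos (of_int m * real j * pi / real K) = 1" for j
  proof -
    have "of_int m * real j * pi / real K = 2 * pi * of_int (q * int j)" using K by (simp add: q)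
    then show ?thesis by (simp only: cos_int_2pin)
  qed
  then show ?thesis using True by simp
next
  case False
  define \<beta> where "\<beta> = of_int m * pi / (2 * real K)"
  have "sin \<beta> \<noteq> 0"
  proof
    assume "sin \<beta> = 0"
    then obtain i :: int where "\<beta> = of_int i * pi" by (auto simp: sin_zero_iff_int2)
    then have "real_of_int m = of_int (i * int (2 * K))" using K by (simp add: \<beta>_def field_simps)
    then have "m = i * int (2 * K)" by (simp only: of_int_eq_iff)
    then show False using False by simp
  qed
  moreover have "2 * sin \<beta> * (\<Sum>j<M. cos (2 * real j * \<beta>)) = sin ((2 * real M - 1) * \<beta>) + sin \<beta>" for M
  proof (induction M)
    case (Suc M)
    have "2 * sin \<beta> * cos (2 * real M * \<beta>) = sin ((2 * real M + 1) * \<beta>) - sin ((2 * real M - 1) * \<beta>)"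
      by (simp add: distrib_right left_diff_distrib sin_add sin_diff)
    moreover have "2 * real (Suc M) - 1 = 2 * real M + 1" by simp
    ultimately show ?case using Suc by (simp only: sum.lessThan_Suc distrib_left)
  qed simp
  \<comment> \<open>Here \<open>4 * K * \<beta>\<close> equals \<open>2 * pi * m\<close>, so the two
    boundary sines cancel.\<close>
  from this[of "2 * K"] have "2 * sin \<beta> * (\<Sum>j<2 * K. cos (2 * real j * \<beta>)) = sin (2 * pi * of_int m - \<beta>) + sin \<beta>"
    using K by (simp add: \<beta>_def field_simps)
  then have "2 * sin \<beta> * (\<Sum>j<2 * K. cos (2 * real j * \<beta>)) = 0"
    by (simp add: sin_diff)
  ultimately have "(\<Sum>j<2 * K. cos (2 * real j * \<beta>)) = 0" by simp
  moreover have "cos (2 * real j * \<beta>) = cos (of_int m * real j * pi / real K)" for j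
    by (simp add: \<beta>_def mult_ac)
  ultimately show ?thesis using False by simp
qed

text \<open>Reflecting \<open>j\<close> to \<open>2 * K - j\<close> changes the sign of both sines
  and so preserves the product, and the terms at 0 and \<open>K\<close> vanish. The sum is thus half
  of a sum over a full period, which product formulas split into four cosine sums.\<close>

lemma sum_cos_sin_sin:
  fixes p x y :: int
  assumes K: "K > 0"
  defines "\<theta> \<equiv> \<lambda>(m :: int) j. of_int m * real j * pi / real K"
    and "\<delta> \<equiv> \<lambda>m. of_bool (int (2 * K) dvd m) :: real"
  shows "(\<Sum>j = 1..<K. cos (\<theta> p j) * sin (\<theta> x j) * sin (\<theta> y j)) =
    real K / 4 * (\<delta> (p + x - y) + \<delta> (p - x + y) - \<delta> (p + x + y) - \<delta> (p - x - y))"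
proof -
  define f where "f j = cos (\<theta> p j) * sin (\<theta> x j) * sin (\<theta> y j)" for j
  have refl_cos: "cos (\<theta> m (2 * K - j)) = cos (\<theta> m j)" and refl_sin: "sin (\<theta> m (2 * K - j)) = - sin (\<theta> m j)"
    if "j \<le> 2 * K" for m j
  proof -
    have "\<theta> m (2 * K - j) = 2 * pi * of_int m - \<theta> m j"
      using K that by (simp add: \<theta>_def of_nat_diff field_simps)
    then show "cos (\<theta> m (2 * K - j)) = cos (\<theta> m j)" "sin (\<theta> m (2 * K - j)) = - sin (\<theta> m j)"
      by (simp_all add: cos_diff sin_diff)
  qed
  have f0: "f 0 = 0" by (simp add: f_def \<theta>_def)
  have "sin (\<theta> x K) = 0" using K by (simp add: \<theta>_def sin_zero_iff_int2)
  then have fK: "f K = 0" by (simp add: f_def)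
  have "(\<Sum>j<2 * K. f j) = (\<Sum>j\<in>{1..<K} \<union> {K<..<2 * K}. f j)"
  proof (rule sum.mono_neutral_right)
    show "\<forall>j\<in>{..<2 * K} - ({1..<K} \<union> {K<..<2 * K}). f j = 0"
    proof
      fix j assume "j \<in> {..<2 * K} - ({1..<K} \<union> {K<..<2 * K})"
      then have "j = 0 \<or> j = K" by auto
      then show "f j = 0" using f0 fK by auto
    qed
  qed auto
  also have "\<dots> = (\<Sum>j = 1..<K. f j) + (\<Sum>j\<in>{K<..<2 * K}. f j)"
    by (intro sum.union_disjoint) auto
  also have "(\<Sum>j\<in>{K<..<2 * K}. f j) = (\<Sum>j = 1..<K. f j)"
    by (rule sum.reindex_bij_witness[of _ "\<lambda>j. 2 * K - j" "\<lambda>j. 2 * K - j"])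
      (auto simp: f_def refl_cos refl_sin)
  finally have half: "(\<Sum>j = 1..<K. f j) = (\<Sum>j<2 * K. f j) / 2" by simp
  have "f j = (cos (\<theta> (p + x - y) j) + cos (\<theta> (p - x + y) j) - cos (\<theta> (p + x + y) j) - cos (\<theta> (p - x - y) j)) / 4" for j
  proof -
    have split: "\<theta> (a + b) j = \<theta> a j + \<theta> b j" "\<theta> (a - b) j = \<theta> a j - \<theta> b j" for a b
      by (simp_all add: \<theta>_def distrib_right left_diff_distrib add_divide_distrib diff_divide_distrib)
    show ?thesis
      by (simp add: f_def split cos_add cos_diff sin_add sin_diff algebra_simps)
  qed
  then have "(\<Sum>j<2 * K. f j) = ((\<Sum>j<2 * K. cos (\<theta> (p + x - y) j)) + (\<Sum>j<2 * K. cos (\<theta> (p - x + y) j))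
    - (\<Sum>j<2 * K. cos (\<theta> (p + x + y) j)) - (\<Sum>j<2 * K. cos (\<theta> (p - x - y) j))) / 4"
    by (simp only: sum.distrib sum_subtractf flip: sum_divide_distrib)
  also have "\<dots> = real K / 2 * (\<delta> (p + x - y) + \<delta> (p - x + y) - \<delta> (p + x + y) - \<delta> (p - x - y))"
    unfolding \<theta>_def cos_sum_period[OF K] \<delta>_def by (simp add: algebra_simps)
  finally show ?thesis using half by (simp add: f_def)
qed

lemma dvd_small_iff:
  fixes D m :: int
  assumes "- D < m" "m < 2 * D"
  shows "D dvd m \<longleftrightarrow> m = 0 \<or> m = D"
proof
  assume "D dvd m"
  then obtain k where k: "m = D * k" ..
  have D: "D > 0" using assms by simp
  have "D * (- 1) < D * k" "D * k < D * 2" using assms k by (simp_all add: mult.commute)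
  then have "- 1 < k" "k < 2" using D by (simp_all only: mult_less_cancel_left_pos)
  then have "k = 0 \<or> k = 1" by auto
  then show "m = 0 \<or> m = D" using k by auto
qed auto

text \<open>All four combinations lie strictly between \<open>- 2 * (n + 3)\<close> and
  \<open>4 * (n + 3)\<close>, so divisibility means being 0 or \<open>2 * (n + 3)\<close>. Only
  \<open>p + x + y\<close> can reach the latter, and it is never 0.\<close>

lemma sum_cos_sn_sn:
  fixes n p x y :: nat
  assumes "1 \<le> x" "x \<le> n + 2" "1 \<le> y" "y \<le> n + 2" "p \<le> n + 3"
  shows "(\<Sum>j = 1..n + 2. cos (real p * real j * pi / (real n + 3)) * sn n (x * j) * sn n (y * j)) =
    (real n + 3) / 4 * (of_bool (p + x = y) + of_bool (p + y = x)
      - of_bool (p + x + y = 2 * (n + 3)) - of_bool (p = x + y))"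
proof -
  let ?\<delta> = "\<lambda>m. of_bool (int (2 * (n + 3)) dvd m) :: real"
  have "{1..n + 2} = {1..<n + 3}" by auto
  then have "(\<Sum>j = 1..n + 2. cos (real p * real j * pi / (real n + 3)) * sn n (x * j) * sn n (y * j)) =
    (real n + 3) / 4 * (?\<delta> (int p + int x - int y) + ?\<delta> (int p - int x + int y)
      - ?\<delta> (int p + int x + int y) - ?\<delta> (int p - int x - int y))"
    using sum_cos_sin_sin[of "n + 3" "int p" "int x" "int y"] by simp
  also have "?\<delta> (int p + int x - int y) = of_bool (p + x = y)"
    by (subst dvd_small_iff) (use assms in auto)
  also have "?\<delta> (int p - int x + int y) = of_bool (p + y = x)"
    by (subst dvd_small_iff) (use assms in auto)
  also have "?\<delta> (int p + int x + int y) = of_bool (p + x + y = 2 * (n + 3))"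
    by (subst dvd_small_iff) (use assms in auto)
  also have "?\<delta> (int p - int x - int y) = of_bool (p = x + y)"
    by (subst dvd_small_iff) (use assms in auto)
  finally show ?thesis .
qed

text \<open>The shift \<open>k + 1\<close> skips the first row of the orthogonal sine transform of
  order \<open>n + 2\<close>; with \<open>k \<le> n\<close> the last row is skipped too.\<close>

definition sine_entry :: "nat \<Rightarrow> nat \<Rightarrow> nat \<Rightarrow> real" where
  "sine_entry n k j = sqrt (2 / (real n + 3)) * sn n ((k + 1) * j)"

lemma sine_entry_mult:
  "sine_entry n k j * sine_entry n l j = 2 / (real n + 3) * (sn n ((k + 1) * j) * sn n ((l + 1) * j))"
proof -
  have *: "sqrt c * x * (sqrt c * y) = (sqrt c * sqrt c) * (x * y)" for c x y
    by (simp only: mult_ac)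
  show ?thesis unfolding sine_entry_def * real_sqrt_mult_self by simp
qed

lemma sine_orthogonal:
  assumes "k \<in> {1..n}" "l \<in> {1..n}"
  shows "(\<Sum>j = 1..n + 2. sine_entry n k j * sine_entry n l j) = of_bool (k = l)"
  using sum_cos_sn_sn[of "k + 1" n "l + 1" 0] assms
  unfolding sine_entry_mult sum_distrib_left[symmetric] by auto

text \<open>At frequency \<open>n + 3 - t\<close> with \<open>t \<le> 3\<close>, the Toeplitz part
  would need \<open>k\<close> and \<open>l\<close> at distance at least \<open>n\<close>, which is
  impossible. The other two cases are the antidiagonals at distance \<open>t\<close> from the main
  one.\<close>

lemma hankel_spectral:
  assumes "k \<in> {1..n}" "l \<in> {1..n}"
  shows "(\<Sum>j = 1..n + 2. lam n a b c d j * (sine_entry n k j * sine_entry n l j)) =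
    (let s = \<bar>int k + int l - int n - 1\<bar> in
     if s = 0 then d else if s = 1 then c else if s = 2 then b else if s = 3 then a else 0)"
proof -
  define C where "C p j = cos (real p * real j * pi / (real n + 3))" for p j :: nat
  define r where "r x j = sn n (x * j)" for x j
  define T where "T p = (\<Sum>j = 1..n + 2. C p j * r (k + 1) j * r (l + 1) j)" for p
  \<comment> \<open>For \<open>t = 0\<close> the two conditions coincide and \<open>D 0\<close>
    counts twice, which is why \<open>d\<close> carries no factor 2 in \<open>lam\<close>.\<close>
  define D where "D t = (of_bool (k + l + t = n + 1) + of_bool (k + l = n + 1 + t) :: real)" for t
  have T: "T (n + 3 - t) = - (real n + 3) / 4 * D t"
    if "t \<le> 3" for t
  proof -
    have "T (n + 3 - t) = (real n + 3) / 4 * (of_bool (n + 3 - t + (k + 1) = l + 1) + of_bool (n + 3 - t + (l + 1) = k + 1)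
      - of_bool (n + 3 - t + (k + 1) + (l + 1) = 2 * (n + 3)) - of_bool (n + 3 - t = k + 1 + (l + 1)))"
      unfolding T_def C_def r_def by (rule sum_cos_sn_sn) (use assms in auto)
    moreover have "(n + 3 - t + (k + 1) = l + 1) = False" "(n + 3 - t + (l + 1) = k + 1) = False"
      "n + 3 - t + (k + 1) + (l + 1) = 2 * (n + 3) \<longleftrightarrow> k + l = n + 1 + t"
      "n + 3 - t = k + 1 + (l + 1) \<longleftrightarrow> k + l + t = n + 1"
      using assms that by auto
    ultimately have "T (n + 3 - t) = (real n + 3) / 4 *
        (of_bool False + of_bool False - of_bool (k + l = n + 1 + t) - of_bool (k + l + t = n + 1))"
      by (simp only:)
    moreover have "u / 4 * (of_bool False + of_bool False - y - z) = - u / 4 * (z + y)" for u y z :: real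
      by (simp add: field_simps)
    ultimately show ?thesis unfolding D_def by (simp only:)
  qed
  have "cos (real j * pi) = C (n + 3) j" for j
    by (simp add: C_def mult.assoc)
  then have lam: "lam n a b c d j = - 2 * a * C n j - 2 * b * C (n + 1) j - 2 * c * C (n + 2) j - d * C (n + 3) j" for j
    by (simp add: lam_def C_def add.commute)
  have "(\<Sum>j = 1..n + 2. lam n a b c d j * (sine_entry n k j * sine_entry n l j)) =
    (\<Sum>j = 1..n + 2. 2 / (real n + 3) * (
       - 2 * a * (C n j * r (k + 1) j * r (l + 1) j)
       - 2 * b * (C (n + 1) j * r (k + 1) j * r (l + 1) j)
       - 2 * c * (C (n + 2) j * r (k + 1) j * r (l + 1) j)
       - d * (C (n + 3) j * r (k + 1) j * r (l + 1) j)))"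
    unfolding sine_entry_mult lam r_def[symmetric]
    by (intro sum.cong refl) (simp add: algebra_simps)
  also have "\<dots> = 2 / (real n + 3) * (- 2 * a * T n - 2 * b * T (n + 1) - 2 * c * T (n + 2) - d * T (n + 3))"
    unfolding T_def sum_distrib_left sum_subtractf[symmetric] ..
  also have "\<dots> = a * D 3 + b * D 2 + c * D 1 + d / 2 * D 0"
  proof -
    have "T n = - (real n + 3) / 4 * D 3" "T (n + 1) = - (real n + 3) / 4 * D 2"
      "T (n + 2) = - (real n + 3) / 4 * D 1" "T (n + 3) = - (real n + 3) / 4 * D 0"
      using T[of 3] T[of 2] T[of 1] T[of 0] by (simp_all add: numeral_3_eq_3 numeral_2_eq_2 One_nat_def)
    moreover have "2 / K * (- 2 * a * (- K / 4 * D 3) - 2 * b * (- K / 4 * D 2) - 2 * c * (- K / 4 * D 1)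
      - d * (- K / 4 * D 0)) = a * D 3 + b * D 2 + c * D 1 + d / 2 * D 0" if "K \<noteq> 0" for K
      using that by (simp add: field_simps)
    from this[of "real n + 3"] have "2 / (real n + 3) * (- 2 * a * (- (real n + 3) / 4 * D 3)
      - 2 * b * (- (real n + 3) / 4 * D 2) - 2 * c * (- (real n + 3) / 4 * D 1)
      - d * (- (real n + 3) / 4 * D 0)) = a * D 3 + b * D 2 + c * D 1 + d / 2 * D 0" by linarith
    ultimately show ?thesis by (simp only:)
  qed
  also have "\<dots> = (let s = \<bar>int k + int l - int n - 1\<bar> in
     if s = 0 then d else if s = 1 then c else if s = 2 then b else if s = 3 then a else 0)"
    by (auto simp: Let_def D_def)
  finally show ?thesis .
qed

section \<open>Splitting the transform columns by parity\<close>

lemma sum_odd_index: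
  fixes n :: nat
  shows
  "(\<Sum>i\<le>(n + 1) div 2. g (2 * i + 1)) = (\<Sum>j\<in>{j\<in>{1..n + 2}. odd j}. g j)"
  by (rule sum.reindex_bij_witness[of _ "\<lambda>j. j div 2" "\<lambda>i. 2 * i + 1"]) (auto elim!: oddE)

text \<open>Index 0 stands for the even index that the matrix \<open>R\<close> omits: \<open>n + 2\<close> for even \<open>n\<close>, \<open>n + 1\<close> for odd \<open>n\<close>.\<close>

definition even_index :: "nat \<Rightarrow> nat \<Rightarrow> nat" where
  "even_index n i = (if i = 0 then 2 * (n div 2 + 1) else 2 * i)"

lemma sum_even_index:
  "(\<Sum>i\<le>n div 2. g (even_index n i)) = (\<Sum>j\<in>{j\<in>{1..n + 2}. even j}. g j)"
proof (rule sum.reindex_bij_witness[of _ "\<lambda>j. if j = 2 * (n div 2 + 1) then 0 else j div 2" "even_index n"])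
  fix j assume "j \<in> {j\<in>{1..n + 2}. even j}"
  then have "j div 2 \<le> n div 2 + 1" "j = 2 * (j div 2)" "j \<noteq> 0" by auto
  then show "(if j = 2 * (n div 2 + 1) then 0 else j div 2) \<in> {..n div 2}"
    "even_index n (if j = 2 * (n div 2 + 1) then 0 else j div 2) = j"
    by (auto simp: even_index_def)
qed (auto simp: even_index_def)

lemma sum_odd_even_index:
  "(\<Sum>j = 1..n + 2. g j) = (\<Sum>i\<le>(n + 1) div 2. g (2 * i + 1)) + (\<Sum>i\<le>n div 2. g (even_index n i))"
proof -
  have "{1..n + 2} = {j\<in>{1..n + 2}. odd j} \<union> {j\<in>{1..n + 2}. even j}" by auto
  then have "(\<Sum>j = 1..n + 2. g j) = (\<Sum>j\<in>{j\<in>{1..n + 2}. odd j} \<union> {j\<in>{1..n + 2}. even j}. g j)" by (rule arg_cong)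
  also have "\<dots> = (\<Sum>j\<in>{j\<in>{1..n + 2}. odd j}. g j) + (\<Sum>j\<in>{j\<in>{1..n + 2}. even j}. g j)"
    by (intro sum.union_disjoint) auto
  finally show ?thesis unfolding sum_odd_index sum_even_index .
qed

text \<open>The sum and the difference of the two half sums are full sums, the signs
  \<open>(- 1) ^ j\<close> being cosines of frequency \<open>n + 3\<close>. The case
  \<open>x = 1\<close> gives \<open>weights\<close>, larger \<open>x\<close> the orthogonality to
  the deleted rows.\<close>

lemma sn_parity_sums:
  assumes x: "x \<in> {1..n + 1}"
  shows "(\<Sum>i\<le>(n + 1) div 2. sn n (2 * i + 1) * sn n (x * (2 * i + 1))) = (real n + 3) / 4 * of_bool (x = 1)"
    and "(\<Sum>i\<le>n div 2. sn n (even_index n i) * sn n (x * even_index n i)) = (real n + 3) / 4 * of_bool (x = 1)"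
proof -
  define g where "g j = sn n j * sn n (x * j)" for j
  define So where "So = (\<Sum>i\<le>(n + 1) div 2. g (2 * i + 1))"
  define Se where "Se = (\<Sum>i\<le>n div 2. g (even_index n i))"
  have "So + Se = (\<Sum>j = 1..n + 2. g j)"
    unfolding sum_odd_even_index So_def Se_def ..
  also have "\<dots> = (\<Sum>j = 1..n + 2. cos (real 0 * real j * pi / (real n + 3)) * sn n (1 * j) * sn n (x * j))"
    by (simp only: g_def of_nat_0 mult_1_left mult_zero_left div_0 cos_zero)
  also have "\<dots> = (real n + 3) / 2 * of_bool (x = 1)"
    using x by (subst sum_cos_sn_sn) auto
  finally have "So + Se = (real n + 3) / 2 * of_bool (x = 1)" .
  moreover have "Se - So = 0"
  proof -
    have cospi: "cos (real (n + 3) * real j * pi / (real n + 3)) = (- 1) ^ j" for j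
      using cos_npi[of j] by (simp add: mult.assoc)
    have "Se - So = (\<Sum>j = 1..n + 2. (- 1) ^ j * g j)"
      unfolding sum_odd_even_index Se_def So_def by (simp add: even_index_def sum_negf)
    also have "\<dots> = (\<Sum>j = 1..n + 2. cos (real (n + 3) * real j * pi / (real n + 3)) * sn n (1 * j) * sn n (x * j))"
      unfolding cospi g_def by (simp only: mult.assoc mult_1_left)
    \<comment> \<open>The bound \<open>x \<le> n + 1\<close> matters: at \<open>x = n + 2\<close>
      the alternating sum is nonzero.\<close>
    also have "\<dots> = 0"
      using x by (subst sum_cos_sn_sn) auto
    finally show ?thesis .
  qed
  ultimately have "So = (real n + 3) / 4 * of_bool (x = 1)" "Se = (real n + 3) / 4 * of_bool (x = 1)"
    by simp_all
  then show "(\<Sum>i\<le>(n + 1) div 2. sn n (2 * i + 1) * sn n (x * (2 * i + 1))) = (real n + 3) / 4 * of_bool (x = 1)"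
    and "(\<Sum>i\<le>n div 2. sn n (even_index n i) * sn n (x * even_index n i)) = (real n + 3) / 4 * of_bool (x = 1)"
    by (simp_all add: So_def Se_def g_def)
qed

lemma sn_pos:
  assumes "1 \<le> j" "j \<le> n + 2"
  shows "sn n j > 0"
proof (rule sin_gt_zero)
  show "0 < real j * pi / (real n + 3)" using assms by simp
  have "real j * pi < (real n + 3) * pi" using assms by (intro mult_strict_right_mono) auto
  then show "real j * pi / (real n + 3) < pi" by (simp add: field_simps)
qed

lemma sn_reflect: "j \<le> n + 3 \<Longrightarrow> sn n (n + 3 - j) = sn n j"
proof -
  assume "j \<le> n + 3"
  then have "real (n + 3 - j) * pi / (real n + 3) = pi - real j * pi / (real n + 3)"
    by (simp add: of_nat_diff field_simps)
  then show ?thesis by (simp only: sin_pi_minus)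
qed

section \<open>Diagonalization and powers\<close>

lemma mat_diag_pow: "mat_diag n z ^\<^sub>m m = mat_diag n (\<lambda>i. z i ^ m)" for z :: "nat \<Rightarrow> 'a :: comm_ring_1"
proof (induction m)
  case 0
  show ?case by (auto simp: mat_diag_def intro!: eq_matI)
qed (simp add: mult.commute)

lemma diagonalized_pow:
  assumes A: "A \<in> carrier_mat n n" and X: "X \<in> carrier_mat n n" and Y: "Y \<in> carrier_mat n n"
    and XY: "X * Y = 1\<^sub>m n" and eq: "cmat A = X * mat_diag n z * Y"
  shows "cmat (A ^\<^sub>m m) = X * mat_diag n (\<lambda>i. z i ^ m) * Y"
proof -
  have "Y * X = 1\<^sub>m n" using mat_mult_left_right_inverse[OF X Y XY] .
  then have "similar_mat_wit (cmat A) (mat_diag n z) X Y"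
    using A X Y XY eq by (intro similar_mat_witI[of _ _ n]) auto
  then show ?thesis
    by (simp add: similar_mat_wit_pow_id mat_diag_pow of_real_hom.mat_hom_pow[OF A])
qed

text \<open>\<open>mat_inverse\<close> is specified through the units of the matrix ring, whereas
  \<open>invertible_mat\<close> yields a matrix whose dimensions must first be read off from the two
  identities.\<close>

lemma mat_inverse_invertible:
  fixes A :: "'a :: field mat"
  assumes A: "A \<in> carrier_mat n n" and inv: "invertible_mat A"
  obtains B where "mat_inverse A = Some B" "B \<in> carrier_mat n n" "A * B = 1\<^sub>m n" "B * A = 1\<^sub>m n"
proof -
  obtain B where B: "A * B = 1\<^sub>m n" "B * A = 1\<^sub>m (dim_row B)"
    using inv A by (auto simp: invertible_mat_def inverts_mat_def)
  have "dim_col B = n" using arg_cong[OF B(1), of dim_col] by simp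
  moreover have "dim_row B = n" using arg_cong[OF B(2), of dim_col] A by simp
  ultimately have "A \<in> Units (ring_mat TYPE('a) n ())"
    using A B by (auto simp: Units_def ring_mat_def intro!: bexI[of _ B])
  then obtain B' where "mat_inverse A = Some B'"
    using mat_inverse(1)[OF A, of "()"] by (cases "mat_inverse A") auto
  then show thesis using mat_inverse(2)[OF A] that by blast
qed

text \<open>Invertibility excludes zeros on the diagonal, so the reciprocals diagonalize the inverse
  and negative exponents reduce to \<open>diagonalized_pow\<close>.\<close>

lemma diagonalized_powi:
  assumes A: "A \<in> carrier_mat n n" and X: "X \<in> carrier_mat n n" and Y: "Y \<in> carrier_mat n n"
    and XY: "X * Y = 1\<^sub>m n" and eq: "cmat A = X * mat_diag n z * Y"
    and inv: "invertible_mat A"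
  shows "cmat (mat_powi A m) = X * mat_diag n (\<lambda>i. z i powi m) * Y"
proof (cases "0 \<le> m")
  case True
  then show ?thesis
    using diagonalized_pow[OF A X Y XY eq, of "nat m"] by (simp add: mat_powi_def power_int_def)
next
  case False
  have YX: "Y * X = 1\<^sub>m n" using mat_mult_left_right_inverse[OF X Y XY] .
  obtain B where B: "mat_inverse A = Some B" "B \<in> carrier_mat n n" "A * B = 1\<^sub>m n"
    using mat_inverse_invertible[OF A inv] by metis
  define D where "D = mat_diag n z"
  define D' where "D' = mat_diag n (\<lambda>i. inverse (z i))"
  define C where "C = cmat B"
  have D: "D \<in> carrier_mat n n" "D' \<in> carrier_mat n n" by (simp_all add: D_def D'_def)
  have C: "C \<in> carrier_mat n n" using B by (simp add: C_def)
  have AC: "X * D * Y * C = 1\<^sub>m n"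
    by (simp only: C_def B(3) of_real_hom.mat_hom_one D_def eq[symmetric] flip: of_real_hom.mat_hom_mult[OF A B(2)])
  note assoc = assoc_mult_mat[of _ n n _ n _ n]
  \<comment> \<open>A right inverse of \<open>D\<close> rules out zero rows, hence zero diagonal
    entries.\<close>
  have DZ: "D * (Y * C * X) = 1\<^sub>m n"
  proof -
    have "D * (Y * C * X) = (Y * X) * (D * (Y * C * X))"
      using D X Y C by (simp add: YX)
    also have "\<dots> = Y * (X * D * Y * C) * X"
      using D X Y C by (simp add: assoc)
    also have "\<dots> = 1\<^sub>m n" using X Y by (simp add: AC YX)
    finally show ?thesis .
  qed
  have "z i \<noteq> 0" if "i < n" for i
  proof
    assume "z i = 0"
    moreover have "Y * C * X \<in> carrier_mat n n" using X Y C by simp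
    ultimately have "(D * (Y * C * X)) $$ (i, i) = 0"
      using that unfolding D_def by (subst mat_diag_mult_left) auto
    then show False using that by (simp add: DZ)
  qed
  then have D'D: "D' * D = 1\<^sub>m n"
    unfolding D_def D'_def mat_diag_diag by (auto simp: mat_diag_def intro!: eq_matI)
  \<comment> \<open>Uniqueness of the inverse: the appended factor is the identity
    \<open>cmat A * C\<close>, and everything but \<open>C\<close> collapses.\<close>
  have "X * D' * Y = X * D' * Y * (X * D * Y * C)"
    using D X Y unfolding AC by (intro right_mult_one_mat[symmetric]) auto
  also have "\<dots> = X * (D' * ((Y * X) * (D * (Y * C))))"
    using D X Y C by (simp add: assoc)
  also have "\<dots> = X * ((D' * D) * (Y * C))"
    unfolding YX using D X Y C by (simp add: assoc)
  also have "\<dots> = (X * Y) * C"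
    unfolding D'D using D X Y C by (simp add: assoc)
  finally have "cmat B = X * D' * Y" using C by (simp add: XY C_def)
  from diagonalized_pow[OF B(2) X Y XY this[unfolded D'_def], of "nat (- m)"] show ?thesis
    using False B(1) by (simp add: mat_powi_def power_int_def)
qed

section \<open>Block diagonal matrices\<close>

lemma diag_block2_carrier [simp]:
  "A \<in> carrier_mat N N \<Longrightarrow> B \<in> carrier_mat M M \<Longrightarrow> diag_block_mat [A, B] \<in> carrier_mat (N + M) (N + M)"
  by (auto simp: dim_diag_block_mat intro!: carrier_matI)

lemma diag_block2:
  "A \<in> carrier_mat N N \<Longrightarrow> B \<in> carrier_mat M M \<Longrightarrow>
    diag_block_mat [A, B] = four_block_mat A (0\<^sub>m N M) (0\<^sub>m M N) B"
  by (simp only: diag_block_mat.simps(2)[of A] Let_def diag_block_mat_singleton) auto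

lemma diag_block2_mult:
  fixes A :: "'a :: comm_ring_1 mat"
  assumes "A \<in> carrier_mat N N" "B \<in> carrier_mat M M" "A' \<in> carrier_mat N N" "B' \<in> carrier_mat M M"
  shows "diag_block_mat [A, B] * diag_block_mat [A', B'] = diag_block_mat [A * A', B * B']"
proof -
  have "A * A' \<in> carrier_mat N N" "B * B' \<in> carrier_mat M M" using assms by auto
  then show ?thesis
    using assms by (simp add: diag_block2[of _ N _ M] mult_four_block_mat[of _ N N _ M _ M _ _ N _ M] del: diag_block_mat.simps)
qed

lemma diag_block2_one: "diag_block_mat [1\<^sub>m N, 1\<^sub>m M] = 1\<^sub>m (N + M)"
  by (auto simp: Let_def intro!: eq_matI)

lemma map_diag_block2:
  "A \<in> carrier_mat N N \<Longrightarrow> B \<in> carrier_mat M M \<Longrightarrow>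
    cmat (diag_block_mat [A, B]) = diag_block_mat [cmat A, cmat B]"
  by (auto simp: Let_def intro!: eq_matI)

lemma diag_block2_mat1:
  "diag_block_mat [mat1 N N f, mat1 M M g] = mat1 (N + M) (N + M) (\<lambda>i j.
     if i \<le> N then if j \<le> N then f i j else 0 else if j \<le> N then 0 else g (i - N) (j - N))"
  by (auto simp: Let_def mat1_def Suc_diff_le intro!: eq_matI)

lemma diag_powers_block:
  "diag_powers N M \<phi> \<psi> m = diag_block_mat [mat_diag N (\<lambda>i. \<phi> (i + 1) powi m), mat_diag M (\<lambda>i. \<psi> (i + 1) powi m)]"
  by (auto simp: Let_def diag_powers_def mat_diag_def intro!: eq_matI)

lemma sum_append_index: "(\<Sum>i = 1..N + M. h i) = (\<Sum>i = 1..N. h i) + (\<Sum>i = 1..M. h (N + i))"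
  for h :: "nat \<Rightarrow> 'a :: comm_monoid_add"
  by (induction M) (simp_all add: add.assoc)

text \<open>The hypotheses allow to recover the terms with index 0: \<open>a 0 = - (\<Sum>i = 1..N. a i * s i / s 0)\<close>.\<close>

lemma gram_quadratic_form:
  fixes N :: nat and s a b f :: "nat \<Rightarrow> real"
  assumes s0: "s 0 \<noteq> 0" and a: "(\<Sum>i\<le>N. s i * a i) = 0" and b: "(\<Sum>i\<le>N. s i * b i) = 0"
  shows "(\<Sum>j = 1..N. (\<Sum>i = 1..N. a i * ((if i = j then f j else 0) + f 0 * (s i / s 0) * (s j / s 0))) * b j) =
    (\<Sum>i\<le>N. f i * (a i * b i))"
proof -
  have split: "(\<Sum>i\<le>N. h i) = h 0 + (\<Sum>i = 1..N. h i)" for h :: "nat \<Rightarrow> real"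
  proof -
    have "{..N} - {0} = {1..N}" by auto
    then show ?thesis using sum.remove[of "{..N}" 0 h] by simp
  qed
  have rec: "(\<Sum>i = 1..N. c i * (s i / s 0)) = - c 0" if "(\<Sum>i\<le>N. s i * c i) = 0" for c :: "nat \<Rightarrow> real"
  proof -
    have "(\<Sum>i = 1..N. c i * (s i / s 0)) = (\<Sum>i = 1..N. s i * c i) / s 0"
      by (simp add: sum_divide_distrib mult.commute)
    then show ?thesis using that s0 by (simp add: split add_eq_0_iff)
  qed
  have "(\<Sum>i = 1..N. a i * ((if i = j then f j else 0) + f 0 * (s i / s 0) * (s j / s 0))) =
      f j * a j - f 0 * a 0 * (s j / s 0)" if j: "j \<in> {1..N}" for j
  proof -
    have "(\<Sum>i = 1..N. a i * ((if i = j then f j else 0) + f 0 * (s i / s 0) * (s j / s 0))) =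
      (\<Sum>i = 1..N. a i * (if i = j then f i else 0)) + (\<Sum>i = 1..N. a i * (s i / s 0)) * (f 0 * (s j / s 0))"
      unfolding sum_distrib_right sum.distrib[symmetric]
      by (intro sum.cong refl) (auto simp: algebra_simps)
    then show ?thesis unfolding rec[OF a] using j by (subst (asm) sum_kronecker_right) auto
  qed
  then have "(\<Sum>j = 1..N. (\<Sum>i = 1..N. a i * ((if i = j then f j else 0) + f 0 * (s i / s 0) * (s j / s 0))) * b j) =
    (\<Sum>j = 1..N. (f j * a j - f 0 * a 0 * (s j / s 0)) * b j)"
    by simp
  also have "\<dots> = (\<Sum>j = 1..N. f j * (a j * b j)) - f 0 * a 0 * (\<Sum>j = 1..N. b j * (s j / s 0))"
    unfolding sum_distrib_left sum_subtractf[symmetric] by (intro sum.cong refl) (simp add: algebra_simps)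
  \<comment> \<open>The second use of \<open>rec\<close> yields \<open>- b 0\<close>, so the
    correction becomes the missing term \<open>f 0 * (a 0 * b 0)\<close>.\<close>
  finally show ?thesis unfolding rec[OF b] by (simp add: split)
qed

text \<open>The matrix \<open>Q\<close> of the overview: columns 3, 5, ... of the sine transform,
  then 2, 4, ...; the columns 1 and \<open>even_index n 0\<close> are dropped.\<close>

definition sine_basis :: "nat \<Rightarrow> real mat" where
  "sine_basis n = mat1 n n (\<lambda>k l.
     if l \<le> (n + 1) div 2 then sine_entry n k (2 * l + 1) else sine_entry n k (2 * (l - (n + 1) div 2)))"

abbreviation gram_odd :: "nat \<Rightarrow> (nat \<Rightarrow> real) \<Rightarrow> real mat" where
  "gram_odd n g \<equiv> gram ((n + 1) div 2) (\<lambda>i. sn n (2 * i + 1)) (\<lambda>i. g (2 * i + 1))"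

abbreviation gram_even :: "nat \<Rightarrow> (nat \<Rightarrow> real) \<Rightarrow> real mat" where
  "gram_even n g \<equiv> gram (n div 2) (\<lambda>i. sn n (even_index n i)) (\<lambda>i. g (even_index n i))"

lemma odd_even_count: "(n + 1) div 2 + n div 2 = n" for n :: nat
  by presburger

lemma even_index_pos: "1 \<le> i \<Longrightarrow> even_index n i = 2 * i"
  by (simp add: even_index_def)

lemma even_index_le: "i \<le> n div 2 \<Longrightarrow> 1 \<le> even_index n i \<and> even_index n i \<le> n + 2"
  by (auto simp: even_index_def)

text \<open>Row \<open>k\<close> has transform index \<open>k + 1 \<ge> 2\<close>, where
  \<open>sn_parity_sums\<close> gives 0. These are the relations from which
  \<open>gram_quadratic_form\<close> restores the dropped columns.\<close>

lemma sine_entry_orthogonal: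
  assumes "k \<in> {1..n}"
  shows "(\<Sum>i\<le>(n + 1) div 2. sn n (2 * i + 1) * sine_entry n k (2 * i + 1)) = 0"
    and "(\<Sum>i\<le>n div 2. sn n (even_index n i) * sine_entry n k (even_index n i)) = 0"
proof -
  have *: "(\<Sum>i\<in>I. p i * sine_entry n k (h i)) = sqrt (2 / (real n + 3)) * (\<Sum>i\<in>I. p i * sn n ((k + 1) * h i))"
    for I :: "nat set" and p :: "nat \<Rightarrow> real" and h
    by (simp only: sine_entry_def sum_distrib_left mult.left_commute)
  have "k + 1 \<in> {1..n + 1}" "k + 1 \<noteq> 1" using assms by auto
  then show "(\<Sum>i\<le>(n + 1) div 2. sn n (2 * i + 1) * sine_entry n k (2 * i + 1)) = 0"
    and "(\<Sum>i\<le>n div 2. sn n (even_index n i) * sine_entry n k (even_index n i)) = 0"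
    unfolding * using sn_parity_sums[of "k + 1" n] by (simp_all only: of_bool_eq mult_zero_right)
qed

text \<open>The blocks decouple the parities and \<open>gram_quadratic_form\<close> applies to each.
  Arbitrary \<open>g\<close> covers both the identity (\<open>g\<close> constant 1) and the Hankel
  matrix (\<open>g = lam n a b c d\<close>).\<close>

lemma sine_basis_gram:
  "sine_basis n * diag_block_mat [gram_odd n g, gram_even n g] * transpose_mat (sine_basis n) =
    mat1 n n (\<lambda>k l. \<Sum>j = 1..n + 2. g j * (sine_entry n k j * sine_entry n l j))"
proof -
  define N M where "N = (n + 1) div 2" and "M = n div 2"
  have NM: "N + M = n" unfolding N_def M_def by (rule odd_even_count)
  define a where "a k i = sine_entry n k (2 * i + 1)" for k i
  define b where "b k i = sine_entry n k (even_index n i)" for k i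
  define q where "q k l = (if l \<le> N then a k l else b k (l - N))" for k l
  define fo where "fo i j = (if i = j then g (2 * j + 1) else 0)
     + g (2 * 0 + 1) * (sn n (2 * i + 1) / sn n (2 * 0 + 1)) * (sn n (2 * j + 1) / sn n (2 * 0 + 1))" for i j
  define fe where "fe i j = (if i = j then g (even_index n j) else 0)
     + g (even_index n 0) * (sn n (even_index n i) / sn n (even_index n 0)) * (sn n (even_index n j) / sn n (even_index n 0))" for i j
  define h where "h i j = (if i \<le> N then if j \<le> N then fo i j else 0 else if j \<le> N then 0 else fe (i - N) (j - N))" for i j
  have q: "sine_basis n = mat1 n n q"
    unfolding sine_basis_def q_def a_def b_def N_def[symmetric]
    by (rule mat1_eqI) (auto simp: even_index_def)
  have h: "diag_block_mat [gram_odd n g, gram_even n g] = mat1 n n h"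
    unfolding gram_def N_def[symmetric] M_def[symmetric] diag_block2_mat1 NM h_def fo_def fe_def ..
  show ?thesis
    unfolding q h mat1_mult transpose_mat1
  proof (rule mat1_eqI)
    fix k l assume k: "k \<in> {1..n}" and l: "l \<in> {1..n}"
    have row: "(\<Sum>i = 1..n. q k i * h i j) = (if j \<le> N then (\<Sum>i = 1..N. a k i * fo i j) else (\<Sum>i = 1..M. b k i * fe i (j - N)))" for j
      unfolding NM[symmetric] sum_append_index by (simp add: q_def h_def)
    have "(\<Sum>j = 1..n. (\<Sum>i = 1..n. q k i * h i j) * q l j) =
      (\<Sum>j = 1..N. (\<Sum>i = 1..N. a k i * fo i j) * a l j) + (\<Sum>j = 1..M. (\<Sum>i = 1..M. b k i * fe i j) * b l j)"
      unfolding row unfolding NM[symmetric] sum_append_index by (simp add: q_def)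
    also have "(\<Sum>j = 1..N. (\<Sum>i = 1..N. a k i * fo i j) * a l j) = (\<Sum>i\<le>N. g (2 * i + 1) * (a k i * a l i))"
      unfolding fo_def using sine_entry_orthogonal(1)[OF k] sine_entry_orthogonal(1)[OF l] sn_pos[of "2 * 0 + 1" n]
      by (intro gram_quadratic_form[where f = "\<lambda>i. g (2 * i + 1)" and s = "\<lambda>i. sn n (2 * i + 1)"]) (simp_all only: a_def N_def, simp)
    also have "(\<Sum>j = 1..M. (\<Sum>i = 1..M. b k i * fe i j) * b l j) = (\<Sum>i\<le>M. g (even_index n i) * (b k i * b l i))"
      unfolding fe_def using sine_entry_orthogonal(2)[OF k] sine_entry_orthogonal(2)[OF l] sn_pos[of "even_index n 0" n] even_index_le[of 0 n]
      by (intro gram_quadratic_form[where f = "\<lambda>i. g (even_index n i)" and s = "\<lambda>i. sn n (even_index n i)"]) (simp_all only: b_def M_def, simp)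
    finally show "(\<Sum>j = 1..n. (\<Sum>i = 1..n. q k i * h i j) * q l j) = (\<Sum>j = 1..n + 2. g j * (sine_entry n k j * sine_entry n l j))"
      unfolding sum_odd_even_index a_def b_def N_def M_def .
  qed
qed

corollary sine_basis_one:
  "sine_basis n * diag_block_mat [gram_odd n (\<lambda>_. 1), gram_even n (\<lambda>_. 1)] * transpose_mat (sine_basis n) = 1\<^sub>m n"
proof -
  have "mat1 n n (\<lambda>k l. \<Sum>j = 1..n + 2. 1 * (sine_entry n k j * sine_entry n l j)) = 1\<^sub>m n"
    unfolding one_mat1 mult_1_left by (rule mat1_eqI) (simp only: sine_orthogonal, simp)
  then show ?thesis using sine_basis_gram[of n "\<lambda>_. 1"] by (simp only:)
qed

corollary sine_basis_hankel:
  "sine_basis n * diag_block_mat [gram_odd n (lam n a b c d), gram_even n (lam n a b c d)] * transpose_mat (sine_basis n)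
    = hankel_mat n a b c d"
  unfolding sine_basis_gram hankel_mat_def by (rule mat1_eqI) (rule hankel_spectral)

lemma sum_select:
  fixes n :: nat
  assumes "pos \<in> {1..n}" "\<And>m. m \<in> {1..n} \<Longrightarrow> c m \<longleftrightarrow> m = pos"
  shows "(\<Sum>m = 1..n. f m * (if c m then 1 else 0 :: real)) = f pos"
proof -
  have "(\<Sum>m = 1..n. f m * (if c m then 1 else 0)) = (\<Sum>m = 1..n. if m = pos then f m else 0)"
    using assms(2) by (intro sum.cong) auto
  then show ?thesis using assms(1) by simp
qed

text \<open>Column \<open>m\<close> of \<open>R_even\<close> carries the transform index
  \<open>m + 1\<close>, so 1 and \<open>n + 2\<close> are absent; the permutation sorts the others
  by parity.\<close>

lemma R_P_even:
  assumes n: "even n"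
  shows "R_even n * transpose_mat (P_even n) = sine_basis n"
    and "P_even n * R_even n = transpose_mat (sine_basis n)"
proof -
  obtain N where N: "n = 2 * N" using n by blast
  show *: "R_even n * transpose_mat (P_even n) = sine_basis n"
    unfolding R_even_def P_even_def sine_basis_def transpose_mat1 mat1_mult
  proof (rule mat1_eqI)
    fix k l assume k: "k \<in> {1..n}" and l: "l \<in> {1..n}"
    show "(\<Sum>m = 1..n. sqrt (2 / (real n + 3)) * sn n ((k + 1) * (m + 1)) * (if m = 2 * l \<or> int m = 2 * int l - int n - 1 then 1 else 0)) =
      (if l \<le> (n + 1) div 2 then sine_entry n k (2 * l + 1) else sine_entry n k (2 * (l - (n + 1) div 2)))"
    proof (cases "l \<le> N")
      case True
      then show ?thesis using l N by (subst sum_select[of "2 * l"]) (auto simp: sine_entry_def)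
    next
      case False
      then have "2 * (l - N) = 2 * (l - N) - 1 + 1" by simp
      then show ?thesis using l N False
        by (subst sum_select[of "2 * (l - N) - 1"]) (auto simp: sine_entry_def simp del: of_nat_mult of_nat_add of_nat_diff)
    qed
  qed
  have "transpose_mat (R_even n) = R_even n"
    unfolding R_even_def transpose_mat1 by (simp only: mult.commute)
  moreover have "R_even n \<in> carrier_mat n n" "P_even n \<in> carrier_mat n n" by (simp_all add: R_even_def P_even_def)
  ultimately show "P_even n * R_even n = transpose_mat (sine_basis n)"
    using transpose_mult[of "R_even n" n n "transpose_mat (P_even n)" n] * by simp
qed

text \<open>The last column of \<open>R_odd\<close> carries \<open>n + 2\<close> in place of
  \<open>n + 1\<close>, so that for odd \<open>n\<close>, too, one index of each parity is
  absent.\<close>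

lemma R_P_odd:
  assumes n: "odd n"
  shows "R_odd n * P_odd n = sine_basis n"
    and "transpose_mat (P_odd n) * transpose_mat (R_odd n) = transpose_mat (sine_basis n)"
proof -
  obtain M where M: "n = 2 * M + 1" using n by (auto elim: oddE)
  show *: "R_odd n * P_odd n = sine_basis n"
    unfolding R_odd_def P_odd_def sine_basis_def mat1_mult
  proof (rule mat1_eqI)
    fix k l assume k: "k \<in> {1..n}" and l: "l \<in> {1..n}"
    let ?S = "\<Sum>m = 1..n. sqrt (2 / (real n + 3)) * (if m < n then sn n ((k + 1) * (m + 1)) else sn n ((k + 1) * (n + 2)))
      * (if m = 2 * l \<or> int m = 2 * int l - int n - 2 \<or> m = n \<and> l = (n + 1) div 2 then 1 else 0 :: real)"
    have "l \<le> M \<or> l = M + 1 \<or> l > M + 1" by auto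
    then have "?S = (if l \<le> M + 1 then sine_entry n k (2 * l + 1) else sine_entry n k (2 * (l - (M + 1))))"
    proof (elim disjE)
      assume "l \<le> M"
      then show ?thesis using l M by (subst sum_select[of "2 * l"]) (auto simp: sine_entry_def)
    next
      \<comment> \<open>Here \<open>2 * l = n + 1\<close> lies outside the matrix; the third clause
        of \<open>P_odd\<close> selects the last column, whose index \<open>n + 2\<close> is
        \<open>2 * l + 1\<close>.\<close>
      assume "l = M + 1"
      then show ?thesis using l M by (subst sum_select[of n]) (auto simp: sine_entry_def)
    next
      assume "l > M + 1"
      moreover from this have "2 * (l - (M + 1)) - 1 + 1 = 2 * (l - (M + 1))" by simp
      ultimately show ?thesis using l M
        by (subst sum_select[of "2 * (l - (M + 1)) - 1"]) (auto simp: sine_entry_def simp del: of_nat_mult of_nat_add of_nat_diff)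
    qed
    then show "?S = (if l \<le> (n + 1) div 2 then sine_entry n k (2 * l + 1) else sine_entry n k (2 * (l - (n + 1) div 2)))"
    proof -
      have "(n + 1) div 2 = M + 1" using M by simp
      then show ?thesis using \<open>?S = _\<close> by (simp only:)
    qed
  qed
  show "transpose_mat (P_odd n) * transpose_mat (R_odd n) = transpose_mat (sine_basis n)"
    unfolding *[symmetric] by (rule transpose_mult[of _ n n _ n, symmetric]) (simp_all add: R_odd_def P_odd_def)
qed


section \<open>Assembling the two blocks\<close>

text \<open>\<open>U\<close>, \<open>V\<close> stand for \<open>1 + u u\<^sup>T\<close>,
  \<open>1 + v v\<^sup>T\<close>, and \<open>S\<close>, \<open>T\<close> for the blocks with the
  eigenvalues. The assumption \<open>one\<close> takes the place of orthogonality of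
  \<open>Q\<close>.\<close>

locale block_diagonalization =
  fixes N M :: nat and F F' G G' :: "complex mat" and Q U V S T H :: "real mat"
    and \<phi> \<psi> :: "nat \<Rightarrow> complex"
  assumes carr: "F \<in> carrier_mat N N" "F' \<in> carrier_mat N N" "U \<in> carrier_mat N N" "S \<in> carrier_mat N N"
      "G \<in> carrier_mat M M" "G' \<in> carrier_mat M M" "V \<in> carrier_mat M M" "T \<in> carrier_mat M M"
      "Q \<in> carrier_mat (N + M) (N + M)"
    and inv: "F * F' = 1\<^sub>m N" "G * G' = 1\<^sub>m M"
    and one: "Q * diag_block_mat [U, V] * transpose_mat Q = 1\<^sub>m (N + M)"
    and H: "Q * diag_block_mat [S, T] * transpose_mat Q = H"
    and blocks: "F * mat_diag N (\<lambda>i. \<phi> (i + 1)) * F' * cmat U = cmat S"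
      "G * mat_diag M (\<lambda>i. \<psi> (i + 1)) * G' * cmat V = cmat T"
begin

definition X :: "complex mat" where "X = cmat Q * diag_block_mat [F, G]"

definition Y :: "complex mat" where
  "Y = diag_block_mat [F', G'] * cmat (diag_block_mat [U, V]) * cmat (transpose_mat Q)"

lemma block_carrier:
  "diag_block_mat [F, G] \<in> carrier_mat (N + M) (N + M)"
  "diag_block_mat [F', G'] \<in> carrier_mat (N + M) (N + M)"
  "diag_block_mat [U, V] \<in> carrier_mat (N + M) (N + M)"
  "diag_block_mat [S, T] \<in> carrier_mat (N + M) (N + M)"
  by (intro diag_block2_carrier carr)+

lemma X_carrier: "X \<in> carrier_mat (N + M) (N + M)"
  unfolding X_def using carr block_carrier by (intro mult_carrier_mat[of _ _ "N + M"]) (simp_all only: map_carrier_mat)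

lemma Y_carrier: "Y \<in> carrier_mat (N + M) (N + M)"
  unfolding Y_def using carr block_carrier
  by (intro mult_carrier_mat[of _ _ "N + M"]) (simp_all only: map_carrier_mat transpose_carrier_mat)

text \<open>Serves twice: the identity as \<open>D\<close> gives \<open>X * Y = 1\<close>, the
  diagonal of zeros gives the factorization of \<open>H\<close>.\<close>

lemma sandwich:
  fixes W :: "real mat"
  assumes "W \<in> carrier_mat (N + M) (N + M)" "D \<in> carrier_mat (N + M) (N + M)"
    and eq: "diag_block_mat [F, G] * D * diag_block_mat [F', G'] * cmat (diag_block_mat [U, V]) = cmat W"
  shows "X * D * Y = cmat (Q * W * transpose_mat Q)"
proof -
  define B where "B = diag_block_mat [F, G]"
  define B' where "B' = diag_block_mat [F', G']"
  define E where "E = cmat (diag_block_mat [U, V])"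
  define R where "R = cmat Q"
  define R' where "R' = cmat (transpose_mat Q)"
  have c: "B \<in> carrier_mat (N + M) (N + M)" "B' \<in> carrier_mat (N + M) (N + M)" "E \<in> carrier_mat (N + M) (N + M)"
    "R \<in> carrier_mat (N + M) (N + M)" "R' \<in> carrier_mat (N + M) (N + M)"
    unfolding B_def B'_def E_def R_def R'_def map_carrier_mat transpose_carrier_mat by (intro block_carrier carr)+
  have "R * B * D * (B' * E * R') = R * (B * D * B' * E) * R'"
    using c assms(2) by (simp add: assoc_mult_mat[of _ "N + M" "N + M" _ "N + M" _ "N + M"])
  moreover have "B * D * B' * E = cmat W" using eq by (simp only: B_def B'_def E_def)
  moreover have "cmat (Q * W * transpose_mat Q) = R * cmat W * R'"
    using carr(9) assms(1) by (simp add: R_def R'_def of_real_hom.mat_hom_mult[of _ "N + M" "N + M" _ "N + M"])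
  ultimately show ?thesis by (simp only: X_def Y_def B_def B'_def E_def R_def R'_def)
qed

lemma X_Y: "X * Y = 1\<^sub>m (N + M)"
proof -
  have "diag_block_mat [F, G] * diag_block_mat [F', G'] = 1\<^sub>m (N + M)"
    using carr by (simp only: diag_block2_mult[of _ N _ M] inv diag_block2_one)
  then have "diag_block_mat [F, G] * 1\<^sub>m (N + M) * diag_block_mat [F', G'] * cmat (diag_block_mat [U, V]) =
      cmat (diag_block_mat [U, V])"
    using block_carrier by (simp only: right_mult_one_mat left_mult_one_mat map_carrier_mat)
  from sandwich[OF block_carrier(3) one_carrier_mat this] show ?thesis
    using X_carrier by (simp only: one right_mult_one_mat of_real_hom.mat_hom_one)
qed

lemma H_eq: "cmat H = X * diag_powers N M \<phi> \<psi> 1 * Y"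
proof -
  define D where "D = mat_diag N (\<lambda>i. \<phi> (i + 1))"
  define D' where "D' = mat_diag M (\<lambda>i. \<psi> (i + 1))"
  have c: "D \<in> carrier_mat N N" "D' \<in> carrier_mat M M" "F * D \<in> carrier_mat N N" "G * D' \<in> carrier_mat M M"
    "F * D * F' \<in> carrier_mat N N" "G * D' * G' \<in> carrier_mat M M" "cmat U \<in> carrier_mat N N" "cmat V \<in> carrier_mat M M"
    using carr by (auto simp: D_def D'_def)
  have D: "diag_powers N M \<phi> \<psi> 1 = diag_block_mat [D, D']"
    unfolding diag_powers_block D_def D'_def by (simp only: power_int_1_right)
  have "diag_block_mat [F, G] * diag_powers N M \<phi> \<psi> 1 * diag_block_mat [F', G'] * cmat (diag_block_mat [U, V])
    = cmat (diag_block_mat [S, T])"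
    unfolding D map_diag_block2[OF carr(3,7)] map_diag_block2[OF carr(4,8)] blocks[symmetric] D_def[symmetric] D'_def[symmetric]
    using carr c by (simp only: diag_block2_mult[of _ N _ M])
  from sandwich[OF block_carrier(4) _ this] show ?thesis
    using c by (simp only: D H diag_block2_carrier)
qed

lemma diag_powers_mat_diag:
  "diag_powers N M \<phi> \<psi> m = mat_diag (N + M) (\<lambda>i. (if i < N then \<phi> (i + 1) else \<psi> (i - N + 1)) powi m)"
  unfolding diag_powers_def by (auto simp: mat_diag_def intro!: eq_matI)

lemma H_carrier: "H \<in> carrier_mat (N + M) (N + M)"
  unfolding H[symmetric] using carr(9) block_carrier(4)
  by (intro mult_carrier_mat[of _ _ "N + M"]) (simp_all only: transpose_carrier_mat)

lemma pow: "cmat (H ^\<^sub>m m) = X * diag_powers N M \<phi> \<psi> (int m) * Y"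
  using diagonalized_pow[OF H_carrier X_carrier Y_carrier X_Y, of _ m] H_eq
  unfolding diag_powers_mat_diag by simp

lemma powi: "invertible_mat H \<Longrightarrow> cmat (mat_powi H m) = X * diag_powers N M \<phi> \<psi> m * Y"
  using diagonalized_powi[OF H_carrier X_carrier Y_carrier X_Y, of _ m] H_eq
  unfolding diag_powers_mat_diag by simp

lemma expand:
  assumes R: "R \<in> carrier_mat (N + M) (N + M)" "P \<in> carrier_mat (N + M) (N + M)"
      "P' \<in> carrier_mat (N + M) (N + M)" "R' \<in> carrier_mat (N + M) (N + M)"
    and RP: "R * P = Q" and PR: "P' * R' = transpose_mat Q"
  shows "cmat R * cmat P * diag_block_mat [F, G] * diag_powers N M \<phi> \<psi> m * diag_block_mat [F', G']
      * cmat (diag_block_mat [U, V]) * cmat P' * cmat R' = X * diag_powers N M \<phi> \<psi> m * Y"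
proof -
  define B where "B = diag_block_mat [F, G]"
  define B' where "B' = diag_block_mat [F', G']"
  define E where "E = cmat (diag_block_mat [U, V])"
  define D where "D = diag_powers N M \<phi> \<psi> m"
  have c: "B \<in> carrier_mat (N + M) (N + M)" "B' \<in> carrier_mat (N + M) (N + M)" "E \<in> carrier_mat (N + M) (N + M)"
    "D \<in> carrier_mat (N + M) (N + M)"
    unfolding B_def B'_def E_def D_def diag_powers_mat_diag map_carrier_mat by (intro block_carrier mat_diag_dim)+
  have Q: "cmat Q = cmat R * cmat P" "cmat (transpose_mat Q) = cmat P' * cmat R'"
    using of_real_hom.mat_hom_mult[OF R(1,2)] of_real_hom.mat_hom_mult[OF R(3,4)] by (simp_all only: RP PR)
  show ?thesis
    unfolding X_def Y_def Q B_def[symmetric] B'_def[symmetric] E_def[symmetric] D_def[symmetric]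
    using c R by (simp add: assoc_mult_mat[of _ "N + M" "N + M" _ "N + M" _ "N + M"])
qed

end

text \<open>Covers both parities of \<open>n\<close>: the dropped even index
  \<open>2 * (n div 2 + 1)\<close> is \<open>n + 2\<close> for even and \<open>n + 1\<close> for odd
  \<open>n\<close>, and the block sizes agree in the same way.\<close>

locale hankel_diagonalization =
  fixes n :: nat and a b c d :: real and \<phi> \<psi> :: "nat \<Rightarrow> complex"
  assumes inj_odd: "inj_on (lam n a b c d) {j\<in>{1..n + 2}. odd j}"
    and inj_even: "inj_on (lam n a b c d) {j\<in>{1..n + 2}. even j}"
    and zeros_F: "lists_zeros (F_poly n (lam n a b c d) ((n + 1) div 2)) ((n + 1) div 2) \<phi>"
    and zeros_G: "lists_zeros (G_poly n (lam n a b c d) (lam n a b c d (2 * (n div 2 + 1))) (n div 2)) (n div 2) \<psi>"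
begin

abbreviation "H \<equiv> hankel_mat n a b c d"
abbreviation "L \<equiv> lam n a b c d"
abbreviation "N \<equiv> (n + 1) div 2"
abbreviation "M \<equiv> n div 2"
abbreviation "ls \<equiv> L (2 * (n div 2 + 1))"
abbreviation "FN \<equiv> F_mat n L N \<phi>"
abbreviation "FI \<equiv> F_inv n L N \<phi>"
abbreviation "GM \<equiv> G_mat n L ls M \<psi>"
abbreviation "GI \<equiv> G_inv n L ls M \<psi>"

lemma F_poly_secular:
  "F_poly n L N = secular_poly (4 / (real n + 3)) (\<lambda>i. L (2 * i + 1)) (\<lambda>i. sn n (2 * i + 1)) N"
  unfolding F_poly_def secular_poly_def mult_0_right add_0_left ..

lemma G_poly_secular:
  "G_poly n L ls M = secular_poly (4 / (real n + 3)) (\<lambda>i. L (even_index n i)) (\<lambda>i. sn n (even_index n i)) M"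
proof -
  have "i \<in> {1..M} \<Longrightarrow> i \<noteq> 0" for i by auto
  then show ?thesis
    unfolding G_poly_def secular_poly_def
    by (intro arg_cong2[of _ _ _ _ "(+)"] arg_cong[of _ _ "Polynomial.smult _"] prod.cong sum.cong
        arg_cong2[of _ _ _ _ Polynomial.smult] refl) (auto simp: even_index_def)
qed

sublocale F: secular_block N "4 / (real n + 3)" "\<lambda>i. L (2 * i + 1)" "\<lambda>i. sn n (2 * i + 1)" \<phi>
proof
  show "4 / (real n + 3) * (\<Sum>i\<le>N. (sn n (2 * i + 1))\<^sup>2) = 1"
    using sn_parity_sums(1)[of 1 n] by (simp only: power2_eq_square mult_1_left) auto
  have "2 * i + 1 \<in> {j\<in>{1..n + 2}. odd j}" if "i \<le> N" for i using that by auto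
  then have "inj_on (L \<circ> (\<lambda>i. 2 * i + 1)) {..N}"
    by (intro comp_inj_on inj_on_subset[OF inj_odd]) (auto simp: inj_on_def)
  then show "inj_on (\<lambda>i. L (2 * i + 1)) {..N}" by (simp only: comp_def)
  show "sn n (2 * i + 1) \<noteq> 0" if "i \<le> N" for i
  proof -
    have "1 \<le> 2 * i + 1" "2 * i + 1 \<le> n + 2" using that by auto
    from sn_pos[OF this] show ?thesis by (rule less_imp_neq[symmetric])
  qed
  show "lists_zeros (secular_poly (4 / (real n + 3)) (\<lambda>i. L (2 * i + 1)) (\<lambda>i. sn n (2 * i + 1)) N) N \<phi>"
    using zeros_F unfolding F_poly_secular .
qed

sublocale G: secular_block M "4 / (real n + 3)" "\<lambda>i. L (even_index n i)" "\<lambda>i. sn n (even_index n i)" \<psi>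
proof
  show "4 / (real n + 3) * (\<Sum>i\<le>M. (sn n (even_index n i))\<^sup>2) = 1"
    using sn_parity_sums(2)[of 1 n] by (simp only: power2_eq_square mult_1_left) auto
  have "even_index n i \<in> {j\<in>{1..n + 2}. even j}" if "i \<le> M" for i
    using even_index_le[OF that] by (auto simp: even_index_def)
  moreover have "inj_on (even_index n) {..M}" by (auto simp: inj_on_def even_index_def split: if_splits)
  ultimately have "inj_on (L \<circ> even_index n) {..M}"
    by (intro comp_inj_on inj_on_subset[OF inj_even]) auto
  then show "inj_on (\<lambda>i. L (even_index n i)) {..M}" by (simp only: comp_def)
  show "sn n (even_index n i) \<noteq> 0" if "i \<le> M" for i
    using sn_pos[of "even_index n i" n] even_index_le[OF that] by auto
  show "lists_zeros (secular_poly (4 / (real n + 3)) (\<lambda>i. L (even_index n i)) (\<lambda>i. sn n (even_index n i)) M) M \<psi>"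
    using zeros_G unfolding G_poly_secular .
qed

lemma FN_eq: "FN = F.cauchy_mat"
  by (simp only: F_mat_def F.cauchy_mat_def mult_0_right add_0_left)

lemma FI_eq: "FI = F.cauchy_inv"
  by (simp only: F_inv_def F.cauchy_inv_def mult_0_right add_0_left of_real_diff)

lemma GM_eq: "GM = G.cauchy_mat"
  unfolding G_mat_def G.cauchy_mat_def by (rule mat1_eqI) (auto simp: even_index_def)

lemma GI_eq: "GI = G.cauchy_inv"
proof -
  have pr: "(\<Prod>j = 1..M. \<psi> k - of_real (L (2 * j))) = (\<Prod>j = 1..M. \<psi> k - of_real (L (even_index n j)))" for k
    by (intro prod.cong) (auto simp: even_index_def)
  have pr': "(\<Prod>j\<in>{1..M} - {l}. of_real (L (2 * l) - L (2 * j)) :: complex) =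
    (\<Prod>j\<in>{1..M} - {l}. of_real (L (even_index n l)) - of_real (L (even_index n j)))" if "l \<in> {1..M}" for l
    using that by (intro prod.cong) (auto simp: even_index_def)
  show ?thesis
    unfolding G_inv_def G.cauchy_inv_def
    by (intro arg_cong[of _ _ "smult_mat _"] mat1_eqI, unfold pr, subst pr') (auto simp: even_index_def)
qed

sublocale block_diagonalization N M FN FI GM GI "sine_basis n"
  "gram_odd n (\<lambda>_. 1)" "gram_even n (\<lambda>_. 1)" "gram_odd n L" "gram_even n L" H \<phi> \<psi>
proof
  show "FN \<in> carrier_mat N N" "FI \<in> carrier_mat N N" "GM \<in> carrier_mat M M" "GI \<in> carrier_mat M M"
    unfolding FN_eq FI_eq GM_eq GI_eq by (rule F.cauchy_carrier G.cauchy_carrier)+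
  show "gram_odd n (\<lambda>_. 1) \<in> carrier_mat N N" "gram_even n (\<lambda>_. 1) \<in> carrier_mat M M"
    "gram_odd n L \<in> carrier_mat N N" "gram_even n L \<in> carrier_mat M M"
    by (rule gram_carrier)+
  show "sine_basis n \<in> carrier_mat (N + M) (N + M)"
    unfolding odd_even_count sine_basis_def by simp
  show "FN * FI = 1\<^sub>m N" "GM * GI = 1\<^sub>m M"
    unfolding FN_eq FI_eq GM_eq GI_eq by (rule F.cauchy_cauchy_inv G.cauchy_cauchy_inv)+
  show "FN * mat_diag N (\<lambda>i. \<phi> (i + 1)) * FI * cmat (gram_odd n (\<lambda>_. 1)) = cmat (gram_odd n L)"
    unfolding FN_eq FI_eq by (rule F.cauchy_diagonalizes)
  show "GM * mat_diag M (\<lambda>i. \<psi> (i + 1)) * GI * cmat (gram_even n (\<lambda>_. 1)) = cmat (gram_even n L)"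
    unfolding GM_eq GI_eq by (rule G.cauchy_diagonalizes)
qed (unfold odd_even_count, rule sine_basis_one, rule sine_basis_hankel)

lemma inverts:
  "inverts_mat FN FI" "inverts_mat FI FN" "inverts_mat GM GI" "inverts_mat GI GM"
  using F.cauchy_cauchy_inv F.cauchy_inv_cauchy G.cauchy_cauchy_inv G.cauchy_inv_cauchy carr(1,2,5,6)
  unfolding inverts_mat_def FN_eq[symmetric] FI_eq[symmetric] GM_eq[symmetric] GI_eq[symmetric]
  by (simp_all only: carrier_matD)

lemma conclusion:
  assumes R: "R \<in> carrier_mat n n" "P \<in> carrier_mat n n" "P' \<in> carrier_mat n n" "R' \<in> carrier_mat n n"
    and RP: "R * P = sine_basis n" and PR: "P' * R' = transpose_mat (sine_basis n)"
  defines "rhs \<equiv> \<lambda>m. cmat R * cmat P * diag_block_mat [FN, GM] * diag_powers N M \<phi> \<psi> m * diag_block_mat [FI, GI]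
      * cmat (diag_block_mat [gram_odd n (\<lambda>_. 1), gram_even n (\<lambda>_. 1)]) * cmat P' * cmat R'"
  shows "inverts_mat FN FI \<and> inverts_mat FI FN \<and> inverts_mat GM GI \<and> inverts_mat GI GM
      \<and> (\<forall>m :: nat. m \<ge> 1 \<longrightarrow> cmat (H ^\<^sub>m m) = rhs (int m))
      \<and> (invertible_mat H \<longrightarrow> (\<forall>m :: int. cmat (mat_powi H m) = rhs m))"
proof -
  have "rhs m = X * diag_powers N M \<phi> \<psi> m * Y" for m
    unfolding rhs_def by (rule expand) (use R RP PR in \<open>simp_all only: odd_even_count\<close>)
  then show ?thesis using inverts pow powi by simp
qed

end

lemma gram_one: "gram N s (\<lambda>_. 1) = 1\<^sub>m N + mat1 N 1 (\<lambda>j _. s j / s 0) * transpose_mat (mat1 N 1 (\<lambda>j _. s j / s 0))"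
  unfolding gram_def transpose_mat1 mat1_mult one_mat1 mat1_add by (rule mat1_eqI) simp

lemma gram_u_vec: "1\<^sub>m N + u_vec n N * transpose_mat (u_vec n N) = gram N (\<lambda>i. sn n (2 * i + 1)) (\<lambda>_. 1)"
  unfolding u_vec_def gram_one by (simp only: mult_0_right add_0_left)

text \<open>\<open>gram\<close> divides by the sine at the dropped even index. For odd
  \<open>n\<close> this is literally the denominator of \<open>v_vec_odd\<close>; for even
  \<open>n\<close>, reflection identifies \<open>sn n (n + 2)\<close> with
  \<open>sn n 1\<close>.\<close>

lemma gram_v_vec:
  shows "odd n \<Longrightarrow> 1\<^sub>m (n div 2) + v_vec_odd n (n div 2) * transpose_mat (v_vec_odd n (n div 2)) =
      gram (n div 2) (\<lambda>i. sn n (even_index n i)) (\<lambda>_. 1)"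
    and "even n \<Longrightarrow> 1\<^sub>m (n div 2) + v_vec_even n (n div 2) * transpose_mat (v_vec_even n (n div 2)) =
      gram (n div 2) (\<lambda>i. sn n (even_index n i)) (\<lambda>_. 1)"
proof -
  assume "odd n"
  then have "n + 1 = even_index n 0" by (auto simp: even_index_def elim: oddE)
  then have "v_vec_odd n (n div 2) = mat1 (n div 2) 1 (\<lambda>j _. sn n (2 * j) / sn n (even_index n 0))"
    unfolding v_vec_odd_def by (simp only:)
  also have "\<dots> = mat1 (n div 2) 1 (\<lambda>j _. sn n (even_index n j) / sn n (even_index n 0))"
    by (rule mat1_eqI) (simp only: even_index_pos atLeastAtMost_iff)
  finally have "v_vec_odd n (n div 2) = mat1 (n div 2) 1 (\<lambda>j _. sn n (even_index n j) / sn n (even_index n 0))" .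
  then show "1\<^sub>m (n div 2) + v_vec_odd n (n div 2) * transpose_mat (v_vec_odd n (n div 2)) =
      gram (n div 2) (\<lambda>i. sn n (even_index n i)) (\<lambda>_. 1)"
    unfolding gram_one by (simp only:)
next
  assume "even n"
  then have "even_index n 0 = n + 3 - 1" by (auto simp: even_index_def)
  then have "sn n 1 = sn n (even_index n 0)" using sn_reflect[of 1 n] by (simp only:)
  then have "v_vec_even n (n div 2) = mat1 (n div 2) 1 (\<lambda>j _. sn n (2 * j) / sn n (even_index n 0))"
    unfolding v_vec_even_def by (simp only:)
  also have "\<dots> = mat1 (n div 2) 1 (\<lambda>j _. sn n (even_index n j) / sn n (even_index n 0))"
    by (rule mat1_eqI) (simp only: even_index_pos atLeastAtMost_iff)
  finally have "v_vec_even n (n div 2) = mat1 (n div 2) 1 (\<lambda>j _. sn n (even_index n j) / sn n (even_index n 0))" .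
  then show "1\<^sub>m (n div 2) + v_vec_even n (n div 2) * transpose_mat (v_vec_even n (n div 2)) =
      gram (n div 2) (\<lambda>i. sn n (even_index n i)) (\<lambda>_. 1)"
    unfolding gram_one by (simp only:)
qed

theorem corollary2:
  fixes n :: nat and a b c d :: real and \<phi> \<psi> :: "nat \<Rightarrow> complex"
  assumes "n \<ge> 1"
  shows
    "(let H = hankel_mat n a b c d; L = lam n a b c d;
          N = n div 2; M = n div 2; ls = L (n + 2);
          u = u_vec n N; v = v_vec_even n M; R = R_even n; P = P_even n;
          FN = F_mat n L N \<phi>; GM = G_mat n L ls M \<psi>;
          FI = F_inv n L N \<phi>; GI = G_inv n L ls M \<psi>;
          rhs = (\<lambda>m :: int.
            cmat R * cmat (transpose_mat P) * diag_block_mat [FN, GM]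
            * diag_powers N M \<phi> \<psi> m * diag_block_mat [FI, GI]
            * cmat (diag_block_mat [1\<^sub>m N + u * transpose_mat u, 1\<^sub>m M + v * transpose_mat v])
            * cmat P * cmat R)
      in even n
         \<and> inj_on L {k. odd k \<and> 1 \<le> k \<and> k \<le> n + 1}
         \<and> inj_on L {k. even k \<and> 2 \<le> k \<and> k \<le> n + 2}
         \<and> lists_zeros (F_poly n L N) N \<phi> \<and> lists_zeros (G_poly n L ls M) M \<psi>
         \<longrightarrow> inverts_mat FN FI \<and> inverts_mat FI FN \<and> inverts_mat GM GI \<and> inverts_mat GI GM
             \<and> (\<forall>m :: nat. m \<ge> 1 \<longrightarrow> cmat (H ^\<^sub>m m) = rhs (int m))
             \<and> (invertible_mat H \<longrightarrow> (\<forall>m :: int. cmat (mat_powi H m) = rhs m)))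
     \<and>
     (let H = hankel_mat n a b c d; L = lam n a b c d;
          N = (n + 1) div 2; M = (n - 1) div 2; ls = L (n + 1);
          u = u_vec n N; v = v_vec_odd n M; R = R_odd n; P = P_odd n;
          FN = F_mat n L N \<phi>; GM = G_mat n L ls M \<psi>;
          FI = F_inv n L N \<phi>; GI = G_inv n L ls M \<psi>;
          rhs = (\<lambda>m :: int.
            cmat R * cmat P * diag_block_mat [FN, GM]
            * diag_powers N M \<phi> \<psi> m * diag_block_mat [FI, GI]
            * cmat (diag_block_mat [1\<^sub>m N + u * transpose_mat u, 1\<^sub>m M + v * transpose_mat v])
            * cmat (transpose_mat P) * cmat (transpose_mat R))
      in odd n
         \<and> inj_on L {k. odd k \<and> 1 \<le> k \<and> k \<le> n + 2}
         \<and> inj_on L {k. even k \<and> 2 \<le> k \<and> k \<le> n + 1}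
         \<and> lists_zeros (F_poly n L N) N \<phi> \<and> lists_zeros (G_poly n L ls M) M \<psi>
         \<longrightarrow> inverts_mat FN FI \<and> inverts_mat FI FN \<and> inverts_mat GM GI \<and> inverts_mat GI GM
             \<and> (\<forall>m :: nat. m \<ge> 1 \<longrightarrow> cmat (H ^\<^sub>m m) = rhs (int m))
             \<and> (invertible_mat H \<longrightarrow> (\<forall>m :: int. cmat (mat_powi H m) = rhs m)))"
    (is "?even \<and> ?odd")
proof
  let ?L = "lam n a b c d"
  show ?even
    unfolding Let_def gram_u_vec
  proof (rule impI, goal_cases)
    case 1
    then have n: "even n"
      and inj: "inj_on ?L {k. odd k \<and> 1 \<le> k \<and> k \<le> n + 1}" "inj_on ?L {k. even k \<and> 2 \<le> k \<and> k \<le> n + 2}"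
      and zeros: "lists_zeros (F_poly n ?L (n div 2)) (n div 2) \<phi>"
        "lists_zeros (G_poly n ?L (?L (n + 2)) (n div 2)) (n div 2) \<psi>"
      by blast+
    have half: "(n + 1) div 2 = n div 2" "2 * (n div 2 + 1) = n + 2" using n by auto
    have "{k. odd k \<and> 1 \<le> k \<and> k \<le> n + 1} = {j\<in>{1..n + 2}. odd j}"
      using n by (auto simp: le_Suc_eq)
    moreover have "{k. even k \<and> 2 \<le> k \<and> k \<le> n + 2} = {j\<in>{1..n + 2}. even j}"
      by (auto elim!: evenE)
    ultimately interpret hankel_diagonalization n a b c d \<phi> \<psi>
      using inj zeros by unfold_locales (simp_all only: half)
    have "R_even n \<in> carrier_mat n n" "transpose_mat (P_even n) \<in> carrier_mat n n" "P_even n \<in> carrier_mat n n"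
      by (simp_all add: R_even_def P_even_def)
    from conclusion[OF this this(1) R_P_even[OF n], unfolded half] show ?case
      unfolding gram_v_vec(2)[OF n] .
  qed
  show ?odd
    unfolding Let_def gram_u_vec
  proof (rule impI, goal_cases)
    case 1
    then have n: "odd n"
      and inj: "inj_on ?L {k. odd k \<and> 1 \<le> k \<and> k \<le> n + 2}" "inj_on ?L {k. even k \<and> 2 \<le> k \<and> k \<le> n + 1}"
      and zeros: "lists_zeros (F_poly n ?L ((n + 1) div 2)) ((n + 1) div 2) \<phi>"
        "lists_zeros (G_poly n ?L (?L (n + 1)) ((n - 1) div 2)) ((n - 1) div 2) \<psi>"
      by blast+
    have half: "(n - 1) div 2 = n div 2" "2 * (n div 2 + 1) = n + 1" using n by (auto elim!: oddE)
    have "{k. odd k \<and> 1 \<le> k \<and> k \<le> n + 2} = {j\<in>{1..n + 2}. odd j}" by auto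
    moreover have "even k \<and> 2 \<le> k \<and> k \<le> n + 1 \<longleftrightarrow> k \<in> {1..n + 2} \<and> even k" for k
      using n unfolding atLeastAtMost_iff by presburger
    then have "{k. even k \<and> 2 \<le> k \<and> k \<le> n + 1} = {j\<in>{1..n + 2}. even j}" by blast
    ultimately interpret hankel_diagonalization n a b c d \<phi> \<psi>
      using inj zeros by unfold_locales (simp_all only: half)
    have "R_odd n \<in> carrier_mat n n" "P_odd n \<in> carrier_mat n n"
      "transpose_mat (P_odd n) \<in> carrier_mat n n" "transpose_mat (R_odd n) \<in> carrier_mat n n"
      by (simp_all add: R_odd_def P_odd_def)
    from conclusion[OF this R_P_odd[OF n], unfolded half(2)] show ?case
      unfolding half(1) gram_v_vec(1)[OF n] .
  qed
qed

end
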